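(* Let $m,n\ge2$ be fixed while the dimension $d\to\infty$, and suppose assumptions (A1) and (A2) stated in the context hold. Assume that $\overline\sigma_X^2\ne\overline\sigma_Y^2$ or $\overline\delta_{XY}^2>0$. Let $\phi_{\mathrm{CvM}}=\mathbf 1(U_{\mathrm{CvM}}>c_{\alpha,\mathrm{CvM}})$ be the $\alpha$ level permutation test based on $U_{\mathrm{CvM}}$, with $\alpha\in(0,1)$ satisfying $\alpha>1/\{(m+n)!/(m!\,n!)\}$ when $m\neq n$ and $\alpha>2/\{(m+n)!/(m!\,n!)\}$ when $m=n$. Then $$\lim_{d\to\infty}\mathbb{E}_1[\phi_{\mathrm{CvM}}]=1 .$$
   Context: For each $d$, $X_1,\dots,X_m$ are i.i.d. from $P_X$ and, independently, $Y_1,\dots,Y_n$ i.i.d. from $P_Y$ on $\mathbb{R}^d$ (distributions depending on $d$), with means $\mu_X,\mu_Y$ and positive definite covariance matrices $\Sigma_X,\Sigma_Y$. $\mathbb{E}_1$ is expectation under this model. Standing assumption: for $X\sim P_X,Y\sim P_Y$, $\beta^\top X,\beta^\top Y$ have continuous distribution functions for almost all $\beta$ in the unit sphere. (A1) $\mathrm{Var}(\|Z_1^\ast-Z_2^\ast\|^2)=O(d)$ and $\mathrm{Var}\{(Z_1^\ast-Z_3^\ast)^\top(Z_2^\ast-Z_3^\ast)\}=O(d)$, where $Z_1^\ast,Z_2^\ast,Z_3^\ast$ are independent and each $Z_i^\ast$ follows either $P_X$ or $P_Y$ (for every such choice). (A2) $d^{-1}\mathrm{tr}(\Sigma_X)\to\overline\sigma_X^2$,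 $d^{-1}\mathrm{tr}(\Sigma_Y)\to\overline\sigma_Y^2$, $d^{-1}\|\mu_X-\mu_Y\|^2\to\overline\delta_{XY}^2$, where $0<\overline\sigma_X^2,\overline\sigma_Y^2<\infty$ and $0\le\overline\delta_{XY}^2<\infty$. Statistic: $\mathsf{Ang}(u,v)=\arccos\{u^\top v/(\|u\|\|v\|)\}$, $$h_{\mathrm{CvM}}(x_1,x_2;y_1,y_2)=\tfrac13-\tfrac1{2\pi}\mathsf{Ang}(x_1-y_1,x_2-y_1)-\tfrac1{2\pi}\mathsf{Ang}(y_1-x_1,y_2-x_1),$$ $$U_{\mathrm{CvM}}=\frac1{m(m-1)n(n-1)}\sum_{i_1\ne i_2}\sum_{j_1\neq j_2}h_{\mathrm{CvM}}(X_{i_1},X_{i_2};Y_{j_1},Y_{j_2}).$$ Permutation critical value: with $N=m+n$ and pooled sample $(Z_1,\dots,Z_N)=(X_1,\dots,X_m,Y_1,\dots,Y_n)$, $c_{\alpha,\mathrm{CvM}}=\inf\{t:1-\alpha\le\frac1{N!}\sum_{\varpi}\mathbf 1(U_{\mathrm{CvM}}(Z_\varpi)\le t)\}$, the sum over all permutations $\varpi$ of $\{1,\dots,N\}$, where $U_{\mathrm{CvM}}(Z_\varpi)$ is computed with first sample $Z_{\varpi(1)},\dots,Z_{\varpi(m)}$ and second sample $Z_{\varpi(m+1)},\dots,Z_{\varpi(N)}$. *)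

theory Defs
  imports
    "HOL-Probability.Probability"
    "HOL-Library.Landau_Symbols"
    "HOL-Combinatorics.Permutations"
begin

text \<open>
  As the dimension \<open>d\<close> varies, \<open>\<real>\<^sup>d\<close> is represented by the (extensional) functions on \<open>{..<d}\<close>,
  i.e. the space of the product measure \<open>euclid d\<close>. Coordinates and sample indices start at 0.
\<close>

type_synonym rvec = "nat \<Rightarrow> real"

abbreviation euclid :: "nat \<Rightarrow> rvec measure" where
  "euclid d \<equiv> PiM {..<d} (\<lambda>_. borel)"

definition dot :: "nat \<Rightarrow> rvec \<Rightarrow> rvec \<Rightarrow> real" where
  "dot d u v = (\<Sum>i<d. u i * v i)"

abbreviation vnorm :: "nat \<Rightarrow> rvec \<Rightarrow> real" where
  "vnorm d u \<equiv> L2_set u {..<d}"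

definition mean_vec :: "rvec measure \<Rightarrow> rvec" where
  "mean_vec P i = (\<integral>x. x i \<partial>P)"

definition cov_mat :: "rvec measure \<Rightarrow> nat \<Rightarrow> nat \<Rightarrow> real" where
  "cov_mat P i j = (\<integral>x. (x i - mean_vec P i) * (x j - mean_vec P j) \<partial>P)"

definition mat_trace :: "nat \<Rightarrow> (nat \<Rightarrow> nat \<Rightarrow> real) \<Rightarrow> real" where
  "mat_trace d A = (\<Sum>i<d. A i i)"

definition pos_definite :: "nat \<Rightarrow> (nat \<Rightarrow> nat \<Rightarrow> real) \<Rightarrow> bool" where
  "pos_definite d A \<longleftrightarrow>
     (\<forall>i<d. \<forall>j<d. A i j = A j i) \<and>
     (\<forall>v. (\<exists>i<d. v i \<noteq> 0) \<longrightarrow> (\<Sum>i<d. \<Sum>j<d. v i * A i j * v j) > 0)"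

text \<open>
  The uniform distribution on the unit sphere of \<open>\<real>\<^sup>d\<close> (for \<open>d \<ge> 1\<close>), as the normalised cone measure:
  the law of \<open>x / \<parallel>x\<parallel>\<close> for \<open>x\<close> uniform on the unit ball. It is normalised surface measure, so it has
  the same null sets as surface measure.
\<close>

definition sphere_unif :: "nat \<Rightarrow> rvec measure" where
  "sphere_unif d =
     distr (uniform_measure (PiM {..<d} (\<lambda>_. lborel))
              {x \<in> space (PiM {..<d} (\<lambda>_. lborel)). vnorm d x \<le> 1})
       (euclid d) (\<lambda>x. \<lambda>i\<in>{..<d}. x i / vnorm d x)"

text \<open>
  Standing assumptions on one of the two distributions. Square integrability of the coordinates says
  that the mean and the covariance matrix exist.
\<close>

definition admissible :: "nat \<Rightarrow> rvec measure \<Rightarrow> bool" where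
  "admissible d P \<longleftrightarrow>
     prob_space P \<and> sets P = sets (euclid d) \<and>
     (\<forall>i<d. integrable P (\<lambda>x. (x i)\<^sup>2)) \<and>
     pos_definite d (cov_mat P) \<and>
     (AE \<beta> in sphere_unif d. continuous_on UNIV (cdf (distr P borel (dot d \<beta>))))"

definition pool :: "nat \<Rightarrow> (nat \<Rightarrow> 'a) \<Rightarrow> (nat \<Rightarrow> 'a) \<Rightarrow> nat \<Rightarrow> 'a" where
  "pool m x y k = (if k < m then x k else y (k - m))"

definition two_sample_model ::
  "nat \<Rightarrow> nat \<Rightarrow> nat \<Rightarrow> rvec measure \<Rightarrow> rvec measure \<Rightarrow> 'w measure \<Rightarrow>
     (nat \<Rightarrow> 'w \<Rightarrow> rvec) \<Rightarrow> (nat \<Rightarrow> 'w \<Rightarrow> rvec) \<Rightarrow> bool" where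
  "two_sample_model d m n PX PY M X Y \<longleftrightarrow>
     prob_space M \<and>
     prob_space.indep_vars M (\<lambda>_. euclid d) (pool m X Y) {..<m + n} \<and>
     (\<forall>i<m. distr M (euclid d) (X i) = PX) \<and>
     (\<forall>j<n. distr M (euclid d) (Y j) = PY)"

text \<open>
  \<open>Var (W\<^sub>d) = O(d)\<close>. The integral of a non-integrable function is 0 in the library, so finiteness of
  the variance has to be required explicitly.
\<close>

definition variance_bigo_dim :: "(nat \<Rightarrow> 'a measure) \<Rightarrow> (nat \<Rightarrow> 'a \<Rightarrow> real) \<Rightarrow> bool" where
  "variance_bigo_dim Q W \<longleftrightarrow>
     (\<forall>\<^sub>F d in sequentially. integrable (Q d) (\<lambda>z. (W d z)\<^sup>2)) \<and>
     (\<lambda>d. prob_space.variance (Q d) (W d)) \<in> O(\<lambda>d. real d)"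

definition assumption_A1 :: "(nat \<Rightarrow> rvec measure) \<Rightarrow> (nat \<Rightarrow> rvec measure) \<Rightarrow> bool" where
  "assumption_A1 PX PY \<longleftrightarrow>
     (\<forall>Q1\<in>{PX, PY}. \<forall>Q2\<in>{PX, PY}.
        variance_bigo_dim (\<lambda>d. Q1 d \<Otimes>\<^sub>M Q2 d) (\<lambda>d (z1, z2). (vnorm d (z1 - z2))\<^sup>2)) \<and>
     (\<forall>Q1\<in>{PX, PY}. \<forall>Q2\<in>{PX, PY}. \<forall>Q3\<in>{PX, PY}.
        variance_bigo_dim (\<lambda>d. Q1 d \<Otimes>\<^sub>M Q2 d \<Otimes>\<^sub>M Q3 d)
          (\<lambda>d (z1, z2, z3). dot d (z1 - z3) (z2 - z3)))"

definition assumption_A2 ::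
  "(nat \<Rightarrow> rvec measure) \<Rightarrow> (nat \<Rightarrow> rvec measure) \<Rightarrow> real \<Rightarrow> real \<Rightarrow> real \<Rightarrow> bool" where
  "assumption_A2 PX PY sX2 sY2 delta2 \<longleftrightarrow>
     (\<lambda>d. mat_trace d (cov_mat (PX d)) / real d) \<longlonglongrightarrow> sX2 \<and>
     (\<lambda>d. mat_trace d (cov_mat (PY d)) / real d) \<longlonglongrightarrow> sY2 \<and>
     (\<lambda>d. (vnorm d (mean_vec (PX d) - mean_vec (PY d)))\<^sup>2 / real d) \<longlonglongrightarrow> delta2 \<and>
     0 < sX2 \<and> 0 < sY2 \<and> 0 \<le> delta2"

text \<open>
  If \<open>u\<close> or \<open>v\<close> is zero the angle is \<open>\<pi> / 2\<close>, since division by zero yields zero; for the continuous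
  distributions considered here this occurs with probability zero.
\<close>

definition Ang :: "nat \<Rightarrow> rvec \<Rightarrow> rvec \<Rightarrow> real" where
  "Ang d u v = arccos (dot d u v / (vnorm d u * vnorm d v))"

definition h_CvM :: "nat \<Rightarrow> rvec \<Rightarrow> rvec \<Rightarrow> rvec \<Rightarrow> rvec \<Rightarrow> real" where
  "h_CvM d x1 x2 y1 y2 =
     1 / 3 - 1 / (2 * pi) * Ang d (x1 - y1) (x2 - y1) - 1 / (2 * pi) * Ang d (y1 - x1) (y2 - x1)"

definition U_CvM :: "nat \<Rightarrow> nat \<Rightarrow> nat \<Rightarrow> (nat \<Rightarrow> rvec) \<Rightarrow> (nat \<Rightarrow> rvec) \<Rightarrow> real" where
  "U_CvM d m n x y =
     1 / (real m * (real m - 1) * real n * (real n - 1)) *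
     (\<Sum>(i1, i2)\<in>{(i1, i2). i1 < m \<and> i2 < m \<and> i1 \<noteq> i2}.
      \<Sum>(j1, j2)\<in>{(j1, j2). j1 < n \<and> j2 < n \<and> j1 \<noteq> j2}.
        h_CvM d (x i1) (x i2) (y j1) (y j2))"

definition crit_CvM :: "nat \<Rightarrow> nat \<Rightarrow> nat \<Rightarrow> real \<Rightarrow> (nat \<Rightarrow> rvec) \<Rightarrow> real" where
  "crit_CvM d m n \<alpha> z =
     Inf {t. 1 - \<alpha> \<le> 1 / fact (m + n) *
           (\<Sum>p\<in>{p. p permutes {..<m + n}}.
              of_bool (U_CvM d m n (\<lambda>i. z (p i)) (\<lambda>j. z (p (m + j))) \<le> t))}"

definition phi_CvM :: "nat \<Rightarrow> nat \<Rightarrow> nat \<Rightarrow> real \<Rightarrow> (nat \<Rightarrow> rvec) \<Rightarrow> (nat \<Rightarrow> rvec) \<Rightarrow> real" where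
  "phi_CvM d m n \<alpha> x y = of_bool (U_CvM d m n x y > crit_CvM d m n \<alpha> (pool m x y))"

end

theory Submission imports Defs begin

text \<open>
  By polarisation, every angle in the statistic is a function of the squared interpoint distances
  \<open>\<parallel>Z\<^sub>i - Z\<^sub>j\<parallel>\<^sup>2 / d\<close> of the pooled sample. These concentrate in mean square: their variances are \<open>O(1/d)\<close>
  and their means converge to \<open>2 a\<close> within the first sample, \<open>2 b\<close> within the second and
  \<open>a + b + \<delta>\<close> across. In the limit all triangles are isosceles. Let \<open>P\<close>, \<open>Q\<close> be the apex
  angles of the two kinds of mixed triangles (two points of the first, respectively second, sample).
  Each limiting angle is \<open>\<pi> / 3\<close> plus \<open>(2 \<pi> / 3 - P - Q) / 2\<close> times a defect
  that is \<open>-1\<close> exactly at an apex of a mixed triangle, plus a term that is affine in the sample labels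
  and cancels in the sum over ordered pairs. Since \<open>P + Q < 2 \<pi> / 3\<close> unless \<open>a = b\<close> and \<open>\<delta> = 0\<close>,
  the limit of the permuted statistic is maximal only at the permutations that preserve the two samples
  or, when \<open>m = n\<close>, swap them. There are at most \<open>m! n!\<close>, respectively \<open>2 m! n!\<close>, of these,
  and near the limit all other permutations give a strictly smaller value than the observed one.
\<close>

section \<open>Trigonometry of isosceles triangles\<close>

text \<open>Sum-to-product gives \<open>cos P + cos Q = 2 - (A + B)\<close>, which is at least 1. If
  \<open>(P + Q) / 2\<close> were at least pi / 3, its cosine would be at most 1/2, and the product
  could reach 1 only with equality throughout: \<open>A + B = 1\<close> and \<open>P = Q\<close>,
  which \<open>neq\<close> excludes.\<close>

lemma same_apex_angle_sum_less:
  fixes A B :: real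
  assumes "A > 0" "B > 0" "A + B \<le> 1" and neq: "A \<noteq> B \<or> A + B < 1"
  shows "arccos (1 - A) + arccos (1 - B) < 2 * pi / 3"
proof (rule ccontr)
  assume ge: "\<not> ?thesis"
  define P Q where "P = arccos (1 - A)" and "Q = arccos (1 - B)"
  have sum: "(P + Q) / 2 \<ge> pi / 3"
    using ge by (simp add: P_def Q_def)
  have cosPQ: "cos P = 1 - A" "cos Q = 1 - B"
    using assms by (simp_all add: P_def Q_def)
  have range: "0 \<le> P" "P \<le> pi / 2" "0 \<le> Q" "Q \<le> pi / 2"
    unfolding P_def Q_def using assms(1-3)
    by (intro arccos_lbound arccos_le_pi2; linarith)+
  have le: "cos ((P + Q) / 2) \<le> 1 / 2"
    using cos_monotone_0_pi_le[of "pi / 3" "(P + Q) / 2"] sum range cos_60 by auto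
  have nonneg: "cos ((P + Q) / 2) \<ge> 0"
    using range by (intro cos_ge_zero) auto
  have prod: "2 - (A + B) = 2 * cos ((P + Q) / 2) * cos ((P - Q) / 2)"
    using cos_plus_cos[of P Q] cosPQ by simp
  have "2 * cos ((P + Q) / 2) * cos ((P - Q) / 2) \<le> 2 * cos ((P + Q) / 2) * 1"
    using nonneg by (intro mult_left_mono) auto
  with prod le assms have AB: "A + B = 1" and half: "cos ((P + Q) / 2) = 1 / 2"
    by linarith+
  with prod have "cos ((P - Q) / 2) = 1" by simp
  moreover have "\<bar>(P - Q) / 2\<bar> \<le> pi"
    using range by (simp add: abs_le_iff)
  ultimately have "\<bar>(P - Q) / 2\<bar> = 0"
    using arccos_cos_eq_abs[of "(P - Q) / 2"] by simp
  then have "P = Q" by simp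
  then have "A = B" using cosPQ by simp
  with AB neq show False by simp
qed

text \<open>With apex angle \<open>P = arccos (1 - A)\<close>, this is the base angle of an
  isosceles triangle: its cosine is \<open>sin (P / 2)\<close>, evaluated by the half-angle
  formula.\<close>

lemma arccos_base_angle:
  fixes A :: real
  assumes "0 \<le> A" "A \<le> 2"
  shows "arccos (sqrt (A / 2)) = (pi - arccos (1 - A)) / 2"
proof -
  define P where "P = arccos (1 - A)"
  have P: "0 \<le> P" "P \<le> pi" "cos P = 1 - A"
    using assms by (auto simp: P_def intro: arccos_lbound arccos_ubound)
  have "cos ((pi - P) / 2) = sin (P / 2)"
    by (simp add: diff_divide_distrib cos_sin_eq)
  also have "sin (P / 2) = sqrt (A / 2)"
  proof -
    have "cos P = 1 - 2 * (sin (P / 2))\<^sup>2"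
      using cos_double_sin[of "P / 2"] by simp
    then have "(sin (P / 2))\<^sup>2 = A / 2" using P by simp
    moreover have "sin (P / 2) \<ge> 0" using P by (intro sin_ge_zero) auto
    ultimately show ?thesis by (simp add: real_sqrt_unique)
  qed
  finally have "arccos (sqrt (A / 2)) = arccos (cos ((pi - P) / 2))" by simp
  also have "\<dots> = (pi - P) / 2" using P by (intro arccos_cos) auto
  finally show ?thesis by (simp add: P_def)
qed

section \<open>Limiting angles of triangles in the pooled sample\<close>

text \<open>The law of cosines, with \<open>D\<close> the matrix of squared distances.\<close>

definition vertex_angle :: "(nat \<Rightarrow> nat \<Rightarrow> real) \<Rightarrow> nat \<Rightarrow> nat \<Rightarrow> nat \<Rightarrow> real" where
  "vertex_angle D v i j = arccos ((D i v + D j v - D i j) / 2 / (sqrt (D i v) * sqrt (D j v)))"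

text \<open>The permutation only relabels indices while \<open>D\<close> stays fixed, so all
  permuted statistics are functions of one matrix and can be compared at the same limit.\<close>

definition U_dist :: "nat \<Rightarrow> nat \<Rightarrow> (nat \<Rightarrow> nat \<Rightarrow> real) \<Rightarrow> (nat \<Rightarrow> nat) \<Rightarrow> real" where
  "U_dist m n D p =
     1 / (real m * (real m - 1) * real n * (real n - 1)) *
     (\<Sum>(i1, i2)\<in>{(i1, i2). i1 < m \<and> i2 < m \<and> i1 \<noteq> i2}.
      \<Sum>(j1, j2)\<in>{(j1, j2). j1 < n \<and> j2 < n \<and> j1 \<noteq> j2}.
        1 / 3 - 1 / (2 * pi) * vertex_angle D (p (m + j1)) (p i1) (p i2)
              - 1 / (2 * pi) * vertex_angle D (p i1) (p (m + j1)) (p (m + j2)))"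

text \<open>Here \<open>a\<close> and \<open>b\<close> are the limiting variances per coordinate and
  \<open>e\<close> is the limiting squared mean difference per coordinate. The zero diagonal lets
  deviations from this matrix be summed over all pairs of indices.\<close>

definition limit_dist :: "nat \<Rightarrow> real \<Rightarrow> real \<Rightarrow> real \<Rightarrow> nat \<Rightarrow> nat \<Rightarrow> real" where
  "limit_dist m a b e i j =
     (if i = j then 0 else if i < m \<and> j < m then 2 * a else if m \<le> i \<and> m \<le> j then 2 * b
      else a + b + e)"

text \<open>Zero in the equilateral triangles within one sample; in a mixed triangle -1 at the apex
  and 1/2 at each base vertex, so that the defects of every triangle cancel, as the angle sum
  requires.\<close>

definition angle_defect :: "nat \<Rightarrow> nat \<Rightarrow> nat \<Rightarrow> nat \<Rightarrow> real" where
  "angle_defect m v i j =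
     (if (i < m) = (j < m) then (if (i < m) = (v < m) then 0 else - 1) else 1 / 2)"

lemma angle_defect_ge: "angle_defect m v i j \<ge> - 1"
  by (simp add: angle_defect_def)

lemma angle_defect_gt: "(i < m) = (v < m) \<Longrightarrow> angle_defect m v i j > - 1"
  by (auto simp: angle_defect_def)

lemma divide_sqrt_mult_sqrt:
  fixes a c :: real
  assumes "a > 0" "c > 0"
  shows "a / (sqrt (2 * a) * sqrt c) = sqrt (a / c / 2)"
proof -
  have "a / (sqrt (2 * a) * sqrt c) = (a / sqrt a) / (sqrt 2 * sqrt c)"
    by (simp add: real_sqrt_mult)
  also have "\<dots> = sqrt (a / c / 2)"
    using assms by (simp add: real_div_sqrt real_sqrt_divide real_sqrt_mult mult.commute)
  finally show ?thesis .
qed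

text \<open>Within one sample the triangle is equilateral. In a mixed triangle both legs have
  squared length \<open>c\<close> and the base has \<open>2 * a\<close> or \<open>2 * b\<close>; at
  a base vertex the two occurrences of \<open>c\<close> cancel in the numerator, and
  \<open>divide_sqrt_mult_sqrt\<close> simplifies the quotient.\<close>

lemma limit_cosine:
  fixes a b e :: real and m :: nat
  assumes ab: "a > 0" "b > 0" "e \<ge> 0" and distinct: "v \<noteq> i" "v \<noteq> j" "i \<noteq> j"
  defines "D \<equiv> limit_dist m a b e" and "c \<equiv> a + b + e"
  shows "(D i v + D j v - D i j) / 2 / (sqrt (D i v) * sqrt (D j v)) =
      (if (i < m) = (j < m) then if (i < m) = (v < m) then 1 / 2
         else if v < m then 1 - b / c else 1 - a / c
       else if v < m then sqrt (a / c / 2) else sqrt (b / c / 2))"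
proof -
  have c: "c > 0" using ab by (simp add: c_def)
  note base = divide_sqrt_mult_sqrt[OF \<open>a > 0\<close> c] divide_sqrt_mult_sqrt[OF \<open>b > 0\<close> c]
  show ?thesis
    using ab c distinct base
    by (auto simp: D_def limit_dist_def c_def field_simps)
qed

text \<open>Strictness keeps the limiting cosines away from the endpoints -1 and 1, so that
  \<open>arccos\<close> is continuous at them.\<close>

lemma limit_cosine_bounds:
  fixes a b e :: real and m :: nat
  assumes ab: "a > 0" "b > 0" "e \<ge> 0" and distinct: "v \<noteq> i" "v \<noteq> j" "i \<noteq> j"
  defines "D \<equiv> limit_dist m a b e"
  shows "\<bar>(D i v + D j v - D i j) / 2 / (sqrt (D i v) * sqrt (D j v))\<bar> < 1"
proof -
  define c where "c = a + b + e"
  have c: "c > 0" "a < c" "b < c" using ab by (simp_all add: c_def)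
  have 1: "0 < a / c" "a / c < 1" "0 < b / c" "b / c < 1"
    using ab c by auto
  then have "\<bar>sqrt (a / c / 2)\<bar> < 1" "\<bar>sqrt (b / c / 2)\<bar> < 1"
    by (auto intro: real_sqrt_lt_1_iff[THEN iffD2] simp del: divide_divide_eq_left)
  with 1 show ?thesis
    unfolding D_def limit_cosine[OF ab distinct, folded c_def] by auto
qed

text \<open>The two mixed shapes have apex angles \<open>P\<close> and \<open>Q\<close> and base
  angles \<open>(pi - P) / 2\<close> and \<open>(pi - Q) / 2\<close>. Splitting \<open>P\<close> and
  \<open>Q\<close> into mean and half difference puts the mean into the defect term and the half
  difference into a term affine in the labels, in which \<open>v\<close> is weighed against the
  average of \<open>i\<close> and \<open>j\<close>.\<close>

lemma vertex_angle_limit: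
  fixes a b e :: real
  assumes ab: "a > 0" "b > 0" "e \<ge> 0" and distinct: "v \<noteq> i" "v \<noteq> j" "i \<noteq> j"
  defines "P \<equiv> arccos (1 - a / (a + b + e))" and "Q \<equiv> arccos (1 - b / (a + b + e))"
  shows "vertex_angle (limit_dist m a b e) v i j =
     pi / 3 + (2 * pi / 3 - P - Q) / 2 * angle_defect m v i j
       + (Q - P) / 2 * ((of_bool (m \<le> i) + of_bool (m \<le> j)) / 2 - of_bool (m \<le> v))"
proof -
  have c: "a / (a + b + e) \<le> 1" "b / (a + b + e) \<le> 1" "0 \<le> a / (a + b + e)" "0 \<le> b / (a + b + e)"
    using ab by auto
  have base: "arccos (sqrt (a / (a + b + e) / 2)) = (pi - P) / 2"
             "arccos (sqrt (b / (a + b + e) / 2)) = (pi - Q) / 2"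
    unfolding P_def Q_def using c by (intro arccos_base_angle; linarith)+
  have half: "arccos (1 / 2) = pi / 3"
    using arccos_cos[of "pi / 3"] cos_60 by simp
  show ?thesis
    unfolding vertex_angle_def limit_cosine[OF ab distinct]
    by (simp only: if_distrib[of arccos] base half P_def[symmetric] Q_def[symmetric])
      (auto simp: angle_defect_def field_simps)
qed

section \<open>The limit of the permuted statistic, its maximisers, and continuity there\<close>

lemma sum_offdiag_diff_eq_0:
  fixes f :: "nat \<Rightarrow> real"
  shows "(\<Sum>(i, j)\<in>{(i, j). i < m \<and> j < m \<and> i \<noteq> j}. f i - f j) = 0"
proof -
  let ?S = "{(i, j). i < m \<and> j < m \<and> i \<noteq> j}"
  have "(\<Sum>(i, j)\<in>?S. f i - f j) = (\<Sum>(i, j)\<in>?S. f j - f i)"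
    by (rule sum.reindex_bij_witness[of _ "\<lambda>(i, j). (j, i)" "\<lambda>(i, j). (j, i)"]) auto
  also have "\<dots> = - (\<Sum>(i, j)\<in>?S. f i - f j)"
    unfolding sum_negf[symmetric] by (rule sum.cong) auto
  finally show ?thesis by simp
qed

lemma sum_offdiag_cong:
  assumes "\<And>i1 i2 j1 j2. i1 < m \<Longrightarrow> i2 < m \<Longrightarrow> i1 \<noteq> i2 \<Longrightarrow> j1 < n \<Longrightarrow> j2 < n \<Longrightarrow> j1 \<noteq> j2 \<Longrightarrow>
    f i1 i2 j1 j2 = g i1 i2 j1 j2"
  shows "(\<Sum>(i1, i2)\<in>{(i1, i2). i1 < m \<and> i2 < m \<and> i1 \<noteq> i2}.
          \<Sum>(j1, j2)\<in>{(j1, j2). j1 < n \<and> j2 < n \<and> j1 \<noteq> j2}. f i1 i2 j1 j2 :: real) =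
         (\<Sum>(i1, i2)\<in>{(i1, i2). i1 < (m::nat) \<and> i2 < m \<and> i1 \<noteq> i2}.
          \<Sum>(j1, j2)\<in>{(j1, j2). j1 < (n::nat) \<and> j2 < n \<and> j1 \<noteq> j2}. g i1 i2 j1 j2)"
  using assms by (intro sum.cong refl) (auto intro!: sum.cong)

lemma finite_offdiag: "finite {(i, j). i < (m::nat) \<and> j < m \<and> i \<noteq> j}"
  by (rule finite_subset[of _ "{..<m} \<times> {..<m}"]) auto

text \<open>The constants cancel, since two angles of pi / 3 weighted by \<open>1 / (2 * pi)\<close>
  make up 1/3. The label terms reduce to a difference between \<open>i1\<close> and
  \<open>i2\<close> and one between \<open>j1\<close> and \<open>j2\<close>, whose sums over ordered
  pairs vanish by antisymmetry.\<close>

lemma U_dist_limit: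
  fixes a b e :: real
  assumes ab: "a > 0" "b > 0" "e \<ge> 0" and inj: "inj_on p {..<m + n}"
  defines "G \<equiv> (2 * pi / 3 - arccos (1 - a / (a + b + e)) - arccos (1 - b / (a + b + e))) / 2"
  shows "U_dist m n (limit_dist k a b e) p =
    1 / (real m * (real m - 1) * real n * (real n - 1)) *
     (\<Sum>(i1, i2)\<in>{(i1, i2). i1 < m \<and> i2 < m \<and> i1 \<noteq> i2}.
      \<Sum>(j1, j2)\<in>{(j1, j2). j1 < n \<and> j2 < n \<and> j1 \<noteq> j2}.
        G / (2 * pi) * (- angle_defect k (p (m + j1)) (p i1) (p i2)
          - angle_defect k (p i1) (p (m + j1)) (p (m + j2))))"
proof -
  \<comment> \<open>The label terms of the two angles add up to half of \<open>l i2 - l i1\<close>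
    plus half of \<open>l (m + j2) - l (m + j1)\<close>. This half and the weight
    \<open>1 / (2 * pi)\<close> give the divisor \<open>4 * pi\<close>; the minus sign of the weight
    reverses the differences.\<close>
  define H where
    "H = (arccos (1 - b / (a + b + e)) - arccos (1 - a / (a + b + e))) / 2 / (4 * pi)"
  define l where "l = (\<lambda>i. of_bool (k \<le> p i) :: real)"
  let ?I = "{(i1, i2). i1 < m \<and> i2 < m \<and> i1 \<noteq> i2}"
  let ?J = "{(j1, j2). j1 < n \<and> j2 < n \<and> j1 \<noteq> j2}"
  let ?D = "limit_dist k a b e"
  have neq: "p x \<noteq> p y" if "x < m + n" "y < m + n" "x \<noteq> y" for x y
    using inj that by (auto simp: inj_on_def)
  have summand: "1 / 3 - 1 / (2 * pi) * vertex_angle ?D (p (m + j1)) (p i1) (p i2)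
              - 1 / (2 * pi) * vertex_angle ?D (p i1) (p (m + j1)) (p (m + j2))
     = G / (2 * pi) * (- angle_defect k (p (m + j1)) (p i1) (p i2)
          - angle_defect k (p i1) (p (m + j1)) (p (m + j2)))
       + H * ((l i1 - l i2) + (l (m + j1) - l (m + j2)))"
    if "i1 < m" "i2 < m" "i1 \<noteq> i2" "j1 < n" "j2 < n" "j1 \<noteq> j2" for i1 i2 j1 j2
  proof -
    have "p (m + j1) \<noteq> p i1" "p (m + j1) \<noteq> p i2" "p (m + j2) \<noteq> p i1" "p i1 \<noteq> p i2"
      "p (m + j1) \<noteq> p (m + j2)"
      using that by (intro neq; simp)+
    then show ?thesis
      using vertex_angle_limit[OF ab, of "p (m + j1)" "p i1" "p i2" k]
        vertex_angle_limit[OF ab, of "p i1" "p (m + j1)" "p (m + j2)" k]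
      by (simp add: G_def[symmetric] H_def l_def) (simp add: field_simps)
  qed
  have inner: "(\<Sum>(j1, j2)\<in>?J. H * (x + (l (m + j1) - l (m + j2)))) = H * real (card ?J) * x" for x
    using sum_offdiag_diff_eq_0[of "\<lambda>j. l (m + j)" n]
    by (simp add: split_def sum_distrib_left[symmetric] sum.distrib mult.assoc)
  have zero: "(\<Sum>(i1, i2)\<in>?I. \<Sum>(j1, j2)\<in>?J. H * ((l i1 - l i2) + (l (m + j1) - l (m + j2)))) = 0"
    using sum_offdiag_diff_eq_0[of l m]
    by (simp add: inner) (simp add: split_def sum_distrib_left[symmetric])
  have "(\<Sum>(i1, i2)\<in>?I. \<Sum>(j1, j2)\<in>?J.
        1 / 3 - 1 / (2 * pi) * vertex_angle ?D (p (m + j1)) (p i1) (p i2)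
              - 1 / (2 * pi) * vertex_angle ?D (p i1) (p (m + j1)) (p (m + j2))) =
     (\<Sum>(i1, i2)\<in>?I. \<Sum>(j1, j2)\<in>?J.
        G / (2 * pi) * (- angle_defect k (p (m + j1)) (p i1) (p i2)
          - angle_defect k (p i1) (p (m + j1)) (p (m + j2)))
        + H * ((l i1 - l i2) + (l (m + j1) - l (m + j2))))"
    by (rule sum_offdiag_cong) (rule summand)
  also have "\<dots> = (\<Sum>(i1, i2)\<in>?I. \<Sum>(j1, j2)\<in>?J.
        G / (2 * pi) * (- angle_defect k (p (m + j1)) (p i1) (p i2)
          - angle_defect k (p i1) (p (m + j1)) (p (m + j2))))"
    using zero by (simp add: sum.distrib split_def)
  finally show ?thesis
    by (simp add: U_dist_def)
qed

text \<open>Under the identity each angle sits at the apex of a mixed triangle, so every defect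
  attains its minimum -1 and no summand for \<open>p\<close> exceeds its counterpart. Two points of
  one original sample that \<open>p\<close> places on opposite sides make a summand strictly
  smaller. The factor \<open>G\<close> is positive by
  \<open>same_apex_angle_sum_less\<close>.\<close>

lemma U_dist_limit_less:
  fixes a b e :: real
  assumes ab: "a > 0" "b > 0" "e \<ge> 0" "a \<noteq> b \<or> e > 0" and mn: "m \<ge> 2" "n \<ge> 2"
    and inj: "inj_on p {..<m + n}"
    and mixed: "i < m" "j < n" "(p i < m) = (p (m + j) < m)"
  shows "U_dist m n (limit_dist m a b e) p < U_dist m n (limit_dist m a b e) id"
proof -
  define G where
    "G = (2 * pi / 3 - arccos (1 - a / (a + b + e)) - arccos (1 - b / (a + b + e))) / 2"
  have c: "a + b + e > 0" using ab by simp
  have "a / (a + b + e) + b / (a + b + e) \<le> 1"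
    using ab c by (simp add: divide_simps)
  moreover have "a / (a + b + e) \<noteq> b / (a + b + e) \<or> a / (a + b + e) + b / (a + b + e) < 1"
    using ab c by (auto simp: divide_simps)
  ultimately have G: "G > 0"
    using same_apex_angle_sum_less[of "a / (a + b + e)" "b / (a + b + e)"] ab c
    by (simp add: G_def)
  let ?f = "\<lambda>p i1 i2 j1 j2. G / (2 * pi) * (- angle_defect m (p (m + j1)) (p i1) (p i2)
          - angle_defect m (p i1) (p (m + j1)) (p (m + j2)))"
  let ?I = "{(i1, i2). i1 < m \<and> i2 < m \<and> i1 \<noteq> i2}"
  let ?J = "{(j1, j2). j1 < n \<and> j2 < n \<and> j1 \<noteq> j2}"
  have le: "?f p i1 i2 j1 j2 \<le> ?f id i1 i2 j1 j2" if "(i1, i2) \<in> ?I" "(j1, j2) \<in> ?J" for i1 i2 j1 j2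
  proof (rule mult_left_mono)
    show "- angle_defect m (p (m + j1)) (p i1) (p i2) - angle_defect m (p i1) (p (m + j1)) (p (m + j2))
      \<le> - angle_defect m (id (m + j1)) (id i1) (id i2) - angle_defect m (id i1) (id (m + j1)) (id (m + j2))"
      using that angle_defect_ge[of m "p (m + j1)" "p i1" "p i2"]
        angle_defect_ge[of m "p i1" "p (m + j1)" "p (m + j2)"]
      by (simp add: angle_defect_def[of m "m + j1"] angle_defect_def[of m i1])
  qed (use G in auto)
  \<comment> \<open>Any partners distinct from \<open>i\<close> and \<open>j\<close> will do, and
    they exist as both samples have at least two points: by \<open>angle_defect_gt\<close>,
    \<open>mixed\<close> alone makes both defects exceed -1.\<close>
  obtain i' j' where ij': "(i, i') \<in> ?I" "(j, j') \<in> ?J"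
  proof
    show "(i, if i = 0 then 1 else 0) \<in> ?I" "(j, if j = 0 then 1 else 0) \<in> ?J"
      using mixed mn by auto
  qed
  have less: "?f p i i' j j' < ?f id i i' j j'"
  proof (rule mult_strict_left_mono)
    show "- angle_defect m (p (m + j)) (p i) (p i') - angle_defect m (p i) (p (m + j)) (p (m + j'))
      < - angle_defect m (id (m + j)) (id i) (id i') - angle_defect m (id i) (id (m + j)) (id (m + j'))"
      using ij' angle_defect_gt[OF mixed(3), of "p i'"]
        angle_defect_gt[OF mixed(3)[symmetric], of "p (m + j')"]
      by (simp add: angle_defect_def[of m "m + j"] angle_defect_def[of m i])
  qed (use G in auto)
  have "(\<Sum>(i1, i2)\<in>?I. \<Sum>(j1, j2)\<in>?J. ?f p i1 i2 j1 j2)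
      < (\<Sum>(i1, i2)\<in>?I. \<Sum>(j1, j2)\<in>?J. ?f id i1 i2 j1 j2)"
  proof (rule sum_strict_mono_ex1[OF finite_offdiag], safe)
    fix i1 i2 assume "i1 < m" "i2 < m" "i1 \<noteq> i2"
    then show "(\<Sum>(j1, j2)\<in>?J. ?f p i1 i2 j1 j2) \<le> (\<Sum>(j1, j2)\<in>?J. ?f id i1 i2 j1 j2)"
      by (intro sum_mono) (use le in auto)
  next
    have "(\<Sum>(j1, j2)\<in>?J. ?f p i i' j1 j2) < (\<Sum>(j1, j2)\<in>?J. ?f id i i' j1 j2)"
    proof (rule sum_strict_mono_ex1[OF finite_offdiag])
      show "\<forall>x\<in>?J. (case x of (j1, j2) \<Rightarrow> ?f p i i' j1 j2) \<le> (case x of (j1, j2) \<Rightarrow> ?f id i i' j1 j2)"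
        using le ij' by auto
      show "\<exists>x\<in>?J. (case x of (j1, j2) \<Rightarrow> ?f p i i' j1 j2) < (case x of (j1, j2) \<Rightarrow> ?f id i i' j1 j2)"
        using less ij' by (intro bexI[of _ "(j, j')"]) auto
    qed
    then show "\<exists>x\<in>?I. (case x of (i1, i2) \<Rightarrow> \<Sum>(j1, j2)\<in>?J. ?f p i1 i2 j1 j2)
        < (case x of (i1, i2) \<Rightarrow> \<Sum>(j1, j2)\<in>?J. ?f id i1 i2 j1 j2)"
      using ij' by (intro bexI[of _ "(i, i')"]) auto
  qed
  then show ?thesis
    unfolding U_dist_limit[OF ab(1-3) inj] U_dist_limit[OF ab(1-3) inj_on_id] G_def[symmetric]
    using mn by (intro mult_strict_left_mono) auto
qed

text \<open>Injectivity of \<open>p\<close> keeps the three vertices of each triangle distinct. At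
  the limit their squared distances are then positive and the cosines lie inside the open interval,
  so each angle is continuous there.\<close>

lemma tendsto_U_dist:
  fixes a b e :: real
  assumes ab: "a > 0" "b > 0" "e \<ge> 0" and p: "inj_on p {..<m + n}" "p ` {..<m + n} \<subseteq> {..<m + n}"
    and D: "\<And>i j. i < m + n \<Longrightarrow> j < m + n \<Longrightarrow> ((\<lambda>x. D x i j) \<longlongrightarrow> limit_dist k a b e i j) F"
  shows "((\<lambda>x. U_dist m n (D x) p) \<longlongrightarrow> U_dist m n (limit_dist k a b e) p) F"
proof -
  let ?D = "limit_dist k a b e"
  have angle: "((\<lambda>x. vertex_angle (D x) v i j) \<longlongrightarrow> vertex_angle ?D v i j) F"
    if "v < m + n" "i < m + n" "j < m + n" "v \<noteq> i" "v \<noteq> j" "i \<noteq> j" for v i j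
    unfolding vertex_angle_def
  proof (rule isCont_tendsto_compose[where g = arccos])
    show "isCont arccos ((?D i v + ?D j v - ?D i j) / 2 / (sqrt (?D i v) * sqrt (?D j v)))"
      using limit_cosine_bounds[OF ab that(4-6), of k] by (intro isCont_arccos) linarith+
    have "sqrt (?D i v) * sqrt (?D j v) \<noteq> 0"
      using ab that by (auto simp: limit_dist_def)
    then show "((\<lambda>x. (D x i v + D x j v - D x i j) / 2 / (sqrt (D x i v) * sqrt (D x j v))) \<longlongrightarrow>
      (?D i v + ?D j v - ?D i j) / 2 / (sqrt (?D i v) * sqrt (?D j v))) F"
      using that by (intro tendsto_intros D) auto
  qed
  have lt: "p i < m + n" if "i < m + n" for i
    using p(2) that by auto
  have neq: "p i \<noteq> p j" if "i < m + n" "j < m + n" "i \<noteq> j" for i j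
    using p(1) that by (auto simp: inj_on_def)
  show ?thesis
    unfolding U_dist_def split_def
    by (intro tendsto_intros angle) (auto simp: lt neq)
qed

section \<open>The critical value and the counting of permutations\<close>

text \<open>The permutation distribution function is a step function, so its quantile lies strictly
  below \<open>u\<close> exactly when enough permuted values do. This replaces the infimum by a
  finite count. The set of levels is nonempty because \<alpha> is positive and bounded below because
  \<alpha> is less than 1.\<close>

lemma U_CvM_less_crit_iff:
  fixes z :: "nat \<Rightarrow> rvec" and \<alpha> u :: real and d m n :: nat
  defines "U \<equiv> \<lambda>p. U_CvM d m n (\<lambda>i. z (p i)) (\<lambda>j. z (p (m + j)))"
  assumes \<alpha>: "0 < \<alpha>" "\<alpha> < 1"
  shows "crit_CvM d m n \<alpha> z < u \<longleftrightarrow>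
    (1 - \<alpha>) * fact (m + n) \<le> (\<Sum>p\<in>{p. p permutes {..<m + n}}. of_bool (U p < u))"
proof -
  let ?P = "{p. p permutes {..<m + n}}"
  define F where "F t = (\<Sum>p\<in>?P. of_bool (U p \<le> t) :: real)" for t
  define T where "T = {t. (1 - \<alpha>) * fact (m + n) \<le> F t}"
  have fin: "finite ?P" by (simp add: finite_permutations)
  have crit: "crit_CvM d m n \<alpha> z = Inf T"
    by (simp add: crit_CvM_def T_def F_def U_def field_simps)
  have pos: "(1 - \<alpha>) * fact (m + n) > 0" using \<alpha> by simp
  have "F (Max (U ` ?P)) = real (card ?P)"
    using fin by (simp add: F_def)
  also have "\<dots> = fact (m + n)" using card_permutations[of "{..<m + n}" "m + n"] by simp
  finally have "Max (U ` ?P) \<in> T" using \<alpha> by (simp add: T_def)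
  then have ne: "T \<noteq> {}" by auto
  have bdd: "bdd_below T"
  proof (rule bdd_belowI)
    fix t assume "t \<in> T"
    show "Min (U ` ?P) \<le> t"
    proof (rule ccontr)
      assume "\<not> ?thesis"
      then have "\<not> U p \<le> t" if "p \<in> ?P" for p
        using Min_le[OF finite_imageI[OF fin] imageI[OF that], of U] by linarith
      then have "F t = 0"
        unfolding F_def by (intro sum.neutral) auto
      then show False using \<open>t \<in> T\<close> pos by (simp add: T_def)
    qed
  qed
  show ?thesis
  proof
    assume "crit_CvM d m n \<alpha> z < u"
    then obtain t where t: "t \<in> T" "t < u"
      unfolding crit cInf_less_iff[OF ne bdd] by auto
    then have "(1 - \<alpha>) * fact (m + n) \<le> F t" by (simp add: T_def)
    also have "\<dots> \<le> (\<Sum>p\<in>?P. of_bool (U p < u))"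
      unfolding F_def using t by (intro sum_mono) auto
    finally show "(1 - \<alpha>) * fact (m + n) \<le> (\<Sum>p\<in>?P. of_bool (U p < u))" .
  next
    assume le: "(1 - \<alpha>) * fact (m + n) \<le> (\<Sum>p\<in>?P. of_bool (U p < u))"
    \<comment> \<open>The largest permuted value below \<open>u\<close> is a level at which all
      values below \<open>u\<close> are already counted. \<open>?L\<close> is nonempty because the
      required count is positive.\<close>
    let ?L = "U ` {p \<in> ?P. U p < u}"
    have "?L \<noteq> {}"
    proof
      assume "?L = {}"
      then have "(\<Sum>p\<in>?P. of_bool (U p < u) :: real) = 0" by (intro sum.neutral) auto
      with le pos show False by simp
    qed
    moreover have finL: "finite ?L" using fin by simp
    ultimately have "Max ?L \<in> ?L" by (rule Max_in[rotated])
    then have "Max ?L < u" by auto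
    have "(\<Sum>p\<in>?P. of_bool (U p < u)) \<le> F (Max ?L)"
      unfolding F_def using finL by (intro sum_mono) auto
    with le have "Max ?L \<in> T" by (simp add: T_def)
    then have "Inf T \<le> Max ?L" using bdd by (rule cInf_lower)
    with \<open>Max ?L < u\<close> show "crit_CvM d m n \<alpha> z < u" by (simp add: crit)
  qed
qed

text \<open>The form with a finite sum of indicators serves both for counting and for
  measurability.\<close>

lemma phi_CvM_eq:
  assumes "0 < \<alpha>" "\<alpha> < 1"
  shows "phi_CvM d m n \<alpha> x y = of_bool ((1 - \<alpha>) * fact (m + n) \<le>
    (\<Sum>p\<in>{p. p permutes {..<m + n}}.
      of_bool (U_CvM d m n (\<lambda>i. pool m x y (p i)) (\<lambda>j. pool m x y (p (m + j)))
        < U_CvM d m n x y)))"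
  by (simp add: phi_CvM_def U_CvM_less_crit_iff[OF assms])

text \<open>An injection of the finite set \<open>A\<close> into itself is onto, so such a
  \<open>p\<close> also maps \<open>B\<close> into itself and factors into a permutation of
  \<open>A\<close> and one of \<open>B\<close>.\<close>

lemma card_block_permutations_le:
  fixes A B :: "'a set"
  assumes "finite A" "finite B" "A \<inter> B = {}"
  shows "card {p. p permutes A \<union> B \<and> p ` A \<subseteq> A} \<le> fact (card A) * fact (card B)"
proof -
  let ?S = "{p. p permutes A \<union> B \<and> p ` A \<subseteq> A}"
  have "?S \<subseteq> (\<lambda>(f, g). f \<circ> g) ` ({f. f permutes A} \<times> {g. g permutes B})"
  proof
    fix p assume "p \<in> ?S"
    then have p: "p permutes A \<union> B" "p ` A \<subseteq> A" by auto
    have inj: "inj p" using p(1) by (rule permutes_inj)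
    have A: "p ` A = A"
      using endo_inj_surj[OF assms(1) p(2)] inj by (simp add: inj_on_subset)
    define f where "f x = (if x \<in> A then p x else x)" for x
    define g where "g x = (if x \<in> B then p x else x)" for x
    have B: "p x \<in> B" if "x \<in> B" for x
    proof -
      have "p x \<in> A \<union> B" using permutes_in_image[OF p(1), of x] that by blast
      moreover have "p x \<notin> A" using A inj that assms(3) by (metis disjoint_iff imageE injD)
      ultimately show ?thesis by auto
    qed
    have "f permutes A" using assms(1) inj A
      by (intro inj_imp_permutes) (auto simp: f_def inj_on_def inj_def)
    moreover have "g permutes B" using assms(2) inj B
      by (intro inj_imp_permutes) (auto simp: g_def inj_on_def inj_def)
    moreover have "p = f \<circ> g"
      using B assms(3) permutes_not_in[OF p(1)] by (auto simp: fun_eq_iff f_def g_def)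
    ultimately show "p \<in> (\<lambda>(f, g). f \<circ> g) ` ({f. f permutes A} \<times> {g. g permutes B})"
      by auto
  qed
  then have "card ?S \<le> card ({f. f permutes A} \<times> {g. g permutes B})"
    by (rule surj_card_le[rotated]) (use assms in \<open>auto intro: finite_permutations\<close>)
  also have "\<dots> = fact (card A) * fact (card B)"
    using assms by (simp add: card_cartesian_product card_permutations)
  finally show ?thesis .
qed

text \<open>An unmixed permutation sends the two blocks to opposite sides, hence preserves them
  (\<open>S1\<close>) or exchanges them (\<open>S2\<close>). The latter needs blocks of equal size,
  and then there are at most as many of them as of the former.\<close>

lemma card_unmixed_permutations_le:
  fixes m n :: nat
  assumes mn: "m \<ge> 1" "n \<ge> 1"
  defines "S \<equiv> {p. p permutes {..<m + n} \<and> (\<forall>i<m. \<forall>j<n. (p i < m) \<noteq> (p (m + j) < m))}"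
  shows "card S \<le> (if m = n then 2 else 1) * (fact m * fact n)"
proof -
  let ?A = "{..<m}" and ?B = "{m..<m + n}"
  have AB: "?A \<union> ?B = {..<m + n}" by auto
  define S1 where "S1 = {p. p permutes {..<m + n} \<and> p ` ?A \<subseteq> ?A}"
  define S2 where "S2 = {p. p permutes {..<m + n} \<and> p ` ?A \<subseteq> ?B \<and> p ` ?B \<subseteq> ?A}"
  have fin: "finite S1" "finite S2"
    by (rule finite_subset[OF _ finite_permutations[of "{..<m + n}"]]; force simp: S1_def S2_def)+
  have S: "S \<subseteq> S1 \<union> S2"
  proof
    fix p assume "p \<in> S"
    then have p: "p permutes {..<m + n}" and ne: "\<And>i j. i < m \<Longrightarrow> j < n \<Longrightarrow> (p i < m) \<noteq> (p (m + j) < m)"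
      by (auto simp: S_def)
    have lt: "p i < m + n" if "i < m + n" for i
      using permutes_in_image[OF p, of i] that by simp
    show "p \<in> S1 \<union> S2"
    \<comment> \<open>Index \<open>m\<close> is the first of the second block, and the side of its
      image fixes the side of every image of the first block.\<close>
    proof (cases "p m < m")
      case True
      then have 1: "p i \<ge> m" if "i < m" for i
        using ne[OF that, of 0] mn by auto
      then have "p (m + j) < m" if "j < n" for j
        using ne[of 0 j] that mn by force
      then have "p k < m" if "m \<le> k" "k < m + n" for k
        using that by (metis add_less_cancel_left le_Suc_ex)
      then show ?thesis using p 1 lt by (auto simp: S2_def)
    next
      case False
      then have "p i < m" if "i < m" for i
        using ne[OF that, of 0] mn by auto
      then show ?thesis using p by (auto simp: S1_def)
    qed
  qed
  have card1: "card S1 \<le> fact m * fact n"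
    using card_block_permutations_le[of ?A ?B] by (simp add: S1_def AB ivl_disj_int)
  show ?thesis
  proof (cases "m = n")
    case True
    \<comment> \<open>The exchange of the two blocks by a shift of \<open>m\<close>; composing with
      it injects \<open>S2\<close> into \<open>S1\<close>.\<close>
    define s where "s k = (if k < m then k + m else if k < m + n then k - m else k)" for k
    have s: "s permutes {..<m + n}"
      using True by (intro inj_imp_permutes) (auto simp: s_def inj_on_def split: if_splits)
    have "(\<lambda>p. s \<circ> p) ` S2 \<subseteq> S1"
    proof safe
      fix p assume "p \<in> S2"
      then have p: "p permutes {..<m + n}" "p ` ?A \<subseteq> ?B" by (auto simp: S2_def)
      have "(s \<circ> p) ` ?A \<subseteq> ?A"
        using p(2) True by (fastforce simp: s_def)
      then show "s \<circ> p \<in> S1"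
        using permutes_compose[OF p(1) s] by (simp add: S1_def)
    qed
    moreover have "inj_on (\<lambda>p. s \<circ> p) S2"
      using permutes_inj[OF s] by (auto simp: inj_on_def fun.inj_map_strong fun_eq_iff dest: injD)
    ultimately have "card S2 \<le> card S1" using fin card_inj_on_le by blast
    then show ?thesis
      using True card1 card_mono[OF _ S] card_Un_le[of S1 S2] fin by simp
  next
    case False
    have "S2 = {}"
    proof safe
      fix p assume "p \<in> S2"
      then have p: "inj p" "p ` ?A \<subseteq> ?B" "p ` ?B \<subseteq> ?A" by (auto simp: S2_def permutes_inj)
      then have "card ?A \<le> card ?B" "card ?B \<le> card ?A"
        by (metis card_inj_on_le finite_atLeastLessThan finite_lessThan inj_on_subset subset_UNIV)+
      then show "p \<in> {}" using False by simp
    qed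
    then show ?thesis using False card1 card_mono[OF _ S] fin by simp
  qed
qed

text \<open>It suffices that every mixed permutation falls strictly below the observed value: the
  unmixed ones, the identity among them, number at most \<open>\<alpha> * fact (m + n)\<close>,
  which is what the lower bounds on \<alpha> provide.\<close>

lemma phi_CvM_eq_1:
  assumes \<alpha>: "0 < \<alpha>" "\<alpha> < 1" and mn: "m \<ge> 1" "n \<ge> 1"
    and \<alpha>1: "m \<noteq> n \<Longrightarrow> \<alpha> > 1 / (fact (m + n) / (fact m * fact n))"
    and \<alpha>2: "m = n \<Longrightarrow> \<alpha> > 2 / (fact (m + n) / (fact m * fact n))"
    and less: "\<And>p i j. p permutes {..<m + n} \<Longrightarrow> i < m \<Longrightarrow> j < n \<Longrightarrow> (p i < m) = (p (m + j) < m) \<Longrightarrow>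
      U_CvM d m n (\<lambda>i. pool m x y (p i)) (\<lambda>j. pool m x y (p (m + j))) < U_CvM d m n x y"
  shows "phi_CvM d m n \<alpha> x y = 1"
proof -
  let ?P = "{p. p permutes {..<m + n}}"
  let ?S = "{p. p permutes {..<m + n} \<and> (\<forall>i<m. \<forall>j<n. (p i < m) \<noteq> (p (m + j) < m))}"
  let ?U = "\<lambda>p. U_CvM d m n (\<lambda>i. pool m x y (p i)) (\<lambda>j. pool m x y (p (m + j)))"
  have fin: "finite ?P" by (simp add: finite_permutations)
  have "real (card ?S) \<le> (if m = n then 2 else 1) * (fact m * fact n)"
    using of_nat_mono[OF card_unmixed_permutations_le[OF mn], where ?'a = real]
    by (simp split: if_splits)
  also have "\<dots> \<le> \<alpha> * fact (m + n)"
    using \<alpha>1 \<alpha>2 by (auto simp: field_simps)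
  finally have "(1 - \<alpha>) * fact (m + n) \<le> fact (m + n) - real (card ?S)"
    by (simp add: algebra_simps)
  also have "\<dots> = real (card ?P) - real (card ?S)"
    using card_permutations[of "{..<m + n}" "m + n"] by simp
  also have "\<dots> = real (card (?P - ?S))"
  proof -
    have sub: "?S \<subseteq> ?P" by auto
    show ?thesis
      using card_Diff_subset[OF finite_subset[OF sub fin] sub] card_mono[OF fin sub]
      by (simp add: of_nat_diff)
  qed
  also have "\<dots> = (\<Sum>p\<in>?P - ?S. of_bool (?U p < U_CvM d m n x y))"
  proof -
    have "real (card (?P - ?S)) = (\<Sum>p\<in>?P - ?S. 1)" by simp
    also have "\<dots> = (\<Sum>p\<in>?P - ?S. of_bool (?U p < U_CvM d m n x y))"
    proof (rule sum.cong)
      fix p assume "p \<in> ?P - ?S"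
      then obtain i j where "p permutes {..<m + n}" "i < m" "j < n" "(p i < m) = (p (m + j) < m)"
        by blast
      from less[OF this] show "1 = of_bool (?U p < U_CvM d m n x y)" by simp
    qed simp
    finally show ?thesis .
  qed
  also have "\<dots> \<le> (\<Sum>p\<in>?P. of_bool (?U p < U_CvM d m n x y))"
    using fin by (intro sum_mono2) auto
  finally show ?thesis
    by (simp add: phi_CvM_eq[OF \<alpha>])
qed

section \<open>Measurability, moments and concentration of squared distances\<close>

text \<open>Outside [-1, 1] the predicate defining \<open>arccos\<close> is unsatisfiable, so the
  definite description denotes one fixed value there. The function is thus continuous on a closed
  interval and constant off it.\<close>

lemma arccos_measurable [measurable]: "arccos \<in> borel_measurable borel"
proof -
  have "arccos x = (if x \<in> {-1..1} then arccos x else (THE x. False))" for x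
  proof (cases "x \<in> {-1..1}")
    case False
    have "(\<lambda>y. 0 \<le> y \<and> y \<le> pi \<and> cos y = x) = (\<lambda>_. False)"
      using False by (auto simp: fun_eq_iff)
    then show ?thesis using False unfolding arccos_def by simp
  qed simp
  then have "arccos = (\<lambda>x. if x \<in> {-1..1} then arccos x else (THE x. False))"
    by (rule ext)
  moreover have "(\<lambda>x. if x \<in> {-1..1} then arccos x else (THE x. False)) \<in> borel_measurable borel"
    by (rule borel_measurable_continuous_on_if)
      (auto intro!: continuous_on_arccos' continuous_intros)
  ultimately show ?thesis by simp
qed

lemma vnorm_sq: "(vnorm d u)\<^sup>2 = (\<Sum>i<d. (u i)\<^sup>2)"
  by (simp add: L2_set_def sum_nonneg)

lemma vnorm_diff_commute: "vnorm d (u - v) = vnorm d (v - u)"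
  by (simp add: L2_set_def power2_commute)

lemma (in prob_space) indep_vars_imp_indep_var:
  assumes "indep_vars N X I" "i \<in> I" "j \<in> I" "i \<noteq> j"
  shows "indep_var (N i) (X i) (N j) (X j)"
proof -
  have "indep_var (PiM {i} N) (\<lambda>\<omega>. restrict (\<lambda>k. X k \<omega>) {i}) (PiM {j} N) (\<lambda>\<omega>. restrict (\<lambda>k. X k \<omega>) {j})"
    using assms by (intro indep_var_restrict[OF assms(1)]) auto
  then have "indep_var (N i) ((\<lambda>f. f i) \<circ> (\<lambda>\<omega>. restrict (\<lambda>k. X k \<omega>) {i}))
     (N j) ((\<lambda>f. f j) \<circ> (\<lambda>\<omega>. restrict (\<lambda>k. X k \<omega>) {j}))"
    by (rule indep_var_compose) auto
  then show ?thesis by (simp add: comp_def)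
qed

text \<open>Independence factors the mixed moment of each coordinate into a product of means, so
  each coordinate contributes both variances and the squared difference of the means.\<close>

lemma (in prob_space) sq_dist_moments:
  assumes indep: "indep_var (euclid d) A (euclid d) B"
    and distr: "distr M (euclid d) A = P" "distr M (euclid d) B = Q"
    and sq: "\<And>i. i < d \<Longrightarrow> integrable P (\<lambda>x. (x i)\<^sup>2)" "\<And>i. i < d \<Longrightarrow> integrable Q (\<lambda>x. (x i)\<^sup>2)"
  shows "integrable M (\<lambda>\<omega>. (vnorm d (A \<omega> - B \<omega>))\<^sup>2)"
    and "expectation (\<lambda>\<omega>. (vnorm d (A \<omega> - B \<omega>))\<^sup>2) =
      mat_trace d (cov_mat P) + mat_trace d (cov_mat Q) + (vnorm d (mean_vec P - mean_vec Q))\<^sup>2"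
proof -
  have A [measurable]: "A \<in> M \<rightarrow>\<^sub>M euclid d" and B [measurable]: "B \<in> M \<rightarrow>\<^sub>M euclid d"
    using indep_var_rv1[OF indep] indep_var_rv2[OF indep] .
  have coord: "integrable M (\<lambda>\<omega>. ((Z \<omega> i)\<^sup>2 :: real))" "integrable M (\<lambda>\<omega>. Z \<omega> i)"
    "expectation (\<lambda>\<omega>. Z \<omega> i) = mean_vec R i"
    "expectation (\<lambda>\<omega>. (Z \<omega> i)\<^sup>2) = cov_mat R i i + (mean_vec R i)\<^sup>2"
    if Z: "Z \<in> M \<rightarrow>\<^sub>M euclid d" "distr M (euclid d) Z = R" "integrable R (\<lambda>x. (x i)\<^sup>2)" "i < d"
    for Z R i
  proof -
    note [measurable] = Z(1)
    have m [measurable]: "(\<lambda>x. x i) \<in> euclid d \<rightarrow>\<^sub>M borel"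
      using \<open>i < d\<close> by (auto intro!: measurable_component_singleton)
    show 1: "integrable M (\<lambda>\<omega>. (Z \<omega> i)\<^sup>2)"
      using Z(3) by (simp add: Z(2)[symmetric] integrable_distr_eq)
    then show 2: "integrable M (\<lambda>\<omega>. Z \<omega> i)"
      by (rule square_integrable_imp_integrable[rotated]) measurable
    show 3: "expectation (\<lambda>\<omega>. Z \<omega> i) = mean_vec R i"
      by (simp add: mean_vec_def Z(2)[symmetric] integral_distr)
    have "cov_mat R i i = expectation (\<lambda>\<omega>. (Z \<omega> i - mean_vec R i)\<^sup>2)"
      by (simp add: cov_mat_def power2_eq_square Z(2)[symmetric] integral_distr)
    then show "expectation (\<lambda>\<omega>. (Z \<omega> i)\<^sup>2) = cov_mat R i i + (mean_vec R i)\<^sup>2"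
      using variance_eq[OF 2 1] 3 by simp
  qed
  have prod: "integrable M (\<lambda>\<omega>. A \<omega> i * B \<omega> i)"
    "expectation (\<lambda>\<omega>. A \<omega> i * B \<omega> i) = mean_vec P i * mean_vec Q i" if "i < d" for i
  proof -
    note cA = coord[OF A distr(1) sq(1)[OF that] that] and cB = coord[OF B distr(2) sq(2)[OF that] that]
    have "indep_var borel ((\<lambda>x. x i) \<circ> A) borel ((\<lambda>x. x i) \<circ> B)"
      using that by (intro indep_var_compose[OF indep]) (auto intro!: measurable_component_singleton)
    then have ind: "indep_var borel (\<lambda>\<omega>. A \<omega> i) borel (\<lambda>\<omega>. B \<omega> i)" by (simp add: comp_def)
    show "integrable M (\<lambda>\<omega>. A \<omega> i * B \<omega> i)"
      using indep_var_integrable[OF ind cA(2) cB(2)] .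
    show "expectation (\<lambda>\<omega>. A \<omega> i * B \<omega> i) = mean_vec P i * mean_vec Q i"
      using indep_var_lebesgue_integral[OF ind cA(2) cB(2)] cA cB by simp
  qed
  have expand: "(vnorm d (A \<omega> - B \<omega>))\<^sup>2 = (\<Sum>i<d. (A \<omega> i)\<^sup>2 + (B \<omega> i)\<^sup>2 - 2 * (A \<omega> i * B \<omega> i))" for \<omega>
    by (simp add: vnorm_sq power2_diff mult.assoc)
  note cA = coord[OF A distr(1) sq(1)] and cB = coord[OF B distr(2) sq(2)]
  show "integrable M (\<lambda>\<omega>. (vnorm d (A \<omega> - B \<omega>))\<^sup>2)"
    unfolding expand using cA cB prod by (intro Bochner_Integration.integrable_sum) auto
  have "expectation (\<lambda>\<omega>. (vnorm d (A \<omega> - B \<omega>))\<^sup>2) =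
    (\<Sum>i<d. expectation (\<lambda>\<omega>. (A \<omega> i)\<^sup>2 + (B \<omega> i)\<^sup>2 - 2 * (A \<omega> i * B \<omega> i)))"
    unfolding expand using cA cB prod by (intro Bochner_Integration.integral_sum) auto
  also have "\<dots> = (\<Sum>i<d. cov_mat P i i + cov_mat Q i i + (mean_vec P i - mean_vec Q i)\<^sup>2)"
    using cA cB prod by (intro sum.cong refl) (simp add: power2_diff)
  also have "\<dots> = mat_trace d (cov_mat P) + mat_trace d (cov_mat Q) + (vnorm d (mean_vec P - mean_vec Q))\<^sup>2"
    by (simp add: mat_trace_def vnorm_sq sum.distrib)
  finally show "expectation (\<lambda>\<omega>. (vnorm d (A \<omega> - B \<omega>))\<^sup>2) =
      mat_trace d (cov_mat P) + mat_trace d (cov_mat Q) + (vnorm d (mean_vec P - mean_vec Q))\<^sup>2" .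
qed

lemma sq_dist_measurable [measurable]:
  assumes [measurable]: "A \<in> N \<rightarrow>\<^sub>M euclid d" "B \<in> N \<rightarrow>\<^sub>M euclid d"
  shows "(\<lambda>\<omega>. (vnorm d (A \<omega> - B \<omega>))\<^sup>2) \<in> borel_measurable N"
proof -
  have [measurable]: "(\<lambda>\<omega>. Z \<omega> i) \<in> borel_measurable N" if "Z \<in> N \<rightarrow>\<^sub>M euclid d" "i < d" for Z i
    using measurable_compose[OF that(1) measurable_component_singleton[of i]] that by simp
  show ?thesis
    unfolding vnorm_sq by (simp, measurable)
qed

text \<open>The bias-variance decomposition of \<open>W / r\<close> around the target
  \<open>l\<close>.\<close>

lemma (in prob_space) mean_square_about:
  fixes W :: "'a \<Rightarrow> real"
  assumes "integrable M W" "integrable M (\<lambda>\<omega>. (W \<omega>)\<^sup>2)"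
  shows "integrable M (\<lambda>\<omega>. (W \<omega> / r - l)\<^sup>2)"
    and "expectation (\<lambda>\<omega>. (W \<omega> / r - l)\<^sup>2) = variance W / r\<^sup>2 + (expectation W / r - l)\<^sup>2"
proof -
  have expand: "(W \<omega> / r - l)\<^sup>2 = (W \<omega>)\<^sup>2 / r\<^sup>2 - 2 * l / r * W \<omega> + l\<^sup>2" for \<omega>
    by (simp add: power2_diff power_divide)
  show "integrable M (\<lambda>\<omega>. (W \<omega> / r - l)\<^sup>2)"
    unfolding expand using assms by auto
  show "expectation (\<lambda>\<omega>. (W \<omega> / r - l)\<^sup>2) = variance W / r\<^sup>2 + (expectation W / r - l)\<^sup>2"
    unfolding expand variance_eq[OF assms] using assms
    by (simp add: prob_space power2_diff power_divide diff_divide_distrib)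
qed

text \<open>By \<open>mean_square_about\<close> the mean square is the variance divided by the
  square of \<open>d\<close>, which is O(1/d) by \<open>var\<close>, plus a squared bias that
  vanishes by \<open>lim\<close>. Second moments of the squared distance are known to be finite only
  from some \<open>d\<close> on, hence the eventual form.\<close>

lemma mean_square_deviation_tendsto_0:
  fixes M :: "nat \<Rightarrow> 'w measure" and P Q :: "nat \<Rightarrow> rvec measure"
  assumes prob: "\<And>d. d \<ge> 1 \<Longrightarrow> prob_space (M d)"
    and indep: "\<And>d. d \<ge> 1 \<Longrightarrow> prob_space.indep_var (M d) (euclid d) (A d) (euclid d) (B d)"
    and distr: "\<And>d. d \<ge> 1 \<Longrightarrow> distr (M d) (euclid d) (A d) = P d"
      "\<And>d. d \<ge> 1 \<Longrightarrow> distr (M d) (euclid d) (B d) = Q d"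
    and sq: "\<And>d i. i < d \<Longrightarrow> integrable (P d) (\<lambda>x. (x i)\<^sup>2)" "\<And>d i. i < d \<Longrightarrow> integrable (Q d) (\<lambda>x. (x i)\<^sup>2)"
    and var: "variance_bigo_dim (\<lambda>d. P d \<Otimes>\<^sub>M Q d) (\<lambda>d (z1, z2). (vnorm d (z1 - z2))\<^sup>2)"
    and lim: "(\<lambda>d. mat_trace d (cov_mat (P d)) / real d) \<longlonglongrightarrow> s"
      "(\<lambda>d. mat_trace d (cov_mat (Q d)) / real d) \<longlonglongrightarrow> t"
      "(\<lambda>d. (vnorm d (mean_vec (P d) - mean_vec (Q d)))\<^sup>2 / real d) \<longlonglongrightarrow> e"
  shows "\<forall>\<^sub>F d in sequentially. integrable (M d) (\<lambda>\<omega>. ((vnorm d (A d \<omega> - B d \<omega>))\<^sup>2 / real d - (s + t + e))\<^sup>2)"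
    and "(\<lambda>d. \<integral>\<omega>. ((vnorm d (A d \<omega> - B d \<omega>))\<^sup>2 / real d - (s + t + e))\<^sup>2 \<partial>M d) \<longlonglongrightarrow> 0"
proof -
  define W where "W d \<omega> = (vnorm d (A d \<omega> - B d \<omega>))\<^sup>2" for d \<omega>
  let ?g = "\<lambda>d (z1, z2). (vnorm d (z1 - z2))\<^sup>2"
  define V where "V d = prob_space.variance (P d \<Otimes>\<^sub>M Q d) (?g d)" for d
  \<comment> \<open>The variance bound concerns the product law, the model random vectors on
    \<open>M d\<close>. Independence makes the product law their joint distribution.\<close>
  have transfer: "integrable (M d) (\<lambda>\<omega>. h (W d \<omega>)) \<longleftrightarrow> integrable (P d \<Otimes>\<^sub>M Q d) (\<lambda>z. h (?g d z))"
      "(\<integral>\<omega>. h (W d \<omega>) \<partial>M d) = (\<integral>z. h (?g d z) \<partial>(P d \<Otimes>\<^sub>M Q d))"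
    if d: "d \<ge> 1" and h [measurable]: "h \<in> borel_measurable borel" for d and h :: "real \<Rightarrow> real"
  proof -
    interpret prob_space "M d" by (rule prob[OF d])
    have rv [measurable]: "A d \<in> M d \<rightarrow>\<^sub>M euclid d" "B d \<in> M d \<rightarrow>\<^sub>M euclid d"
      using indep_var_rv1[OF indep[OF d]] indep_var_rv2[OF indep[OF d]] .
    have law: "P d \<Otimes>\<^sub>M Q d = distr (M d) (euclid d \<Otimes>\<^sub>M euclid d) (\<lambda>\<omega>. (A d \<omega>, B d \<omega>))"
      using indep[OF d] unfolding indep_var_distribution_eq by (simp add: distr[OF d])
    have [measurable]: "?g d \<in> borel_measurable (euclid d \<Otimes>\<^sub>M euclid d)"
      unfolding split_def by measurable
    show "integrable (M d) (\<lambda>\<omega>. h (W d \<omega>)) \<longleftrightarrow> integrable (P d \<Otimes>\<^sub>M Q d) (\<lambda>z. h (?g d z))"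
      unfolding law by (subst integrable_distr_eq) (auto simp: W_def)
    show "(\<integral>\<omega>. h (W d \<omega>) \<partial>M d) = (\<integral>z. h (?g d z) \<partial>(P d \<Otimes>\<^sub>M Q d))"
      unfolding law by (subst integral_distr) (auto simp: W_def)
  qed
  have sqint: "\<forall>\<^sub>F d in sequentially. d \<ge> 1 \<and> integrable (M d) (\<lambda>\<omega>. (W d \<omega>)\<^sup>2)"
    using var[unfolded variance_bigo_dim_def, THEN conjunct1] eventually_ge_at_top[of 1]
    by eventually_elim (simp add: transfer(1)[where h = "\<lambda>x. x\<^sup>2"])
  have EW: "integrable (M d) (W d)"
    "(\<integral>\<omega>. W d \<omega> \<partial>M d) = mat_trace d (cov_mat (P d)) + mat_trace d (cov_mat (Q d))
       + (vnorm d (mean_vec (P d) - mean_vec (Q d)))\<^sup>2" if "d \<ge> 1" for d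
    using prob_space.sq_dist_moments[OF prob indep distr, OF that that that that sq]
    by (simp_all add: W_def[abs_def])
  have E: "integrable (M d) (\<lambda>\<omega>. (W d \<omega> / real d - (s + t + e))\<^sup>2) \<and>
     (\<integral>\<omega>. (W d \<omega> / real d - (s + t + e))\<^sup>2 \<partial>M d) =
     V d / (real d)\<^sup>2 + ((mat_trace d (cov_mat (P d)) + mat_trace d (cov_mat (Q d))
       + (vnorm d (mean_vec (P d) - mean_vec (Q d)))\<^sup>2) / real d - (s + t + e))\<^sup>2"
    if d: "d \<ge> 1" and int: "integrable (M d) (\<lambda>\<omega>. (W d \<omega>)\<^sup>2)" for d
  proof -
    \<comment> \<open>The law is changed twice: first for the mean inside the variance, then for the
      squared deviation from that mean.\<close>
    have "prob_space.variance (M d) (W d) = V d"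
      unfolding V_def transfer(2)[OF d, of "\<lambda>x. x", simplified, symmetric]
      by (rule transfer(2)[OF d]) measurable
    then show ?thesis
      using prob_space.mean_square_about[OF prob[OF d] EW(1)[OF d] int] EW(2)[OF d] by simp
  qed
  show "\<forall>\<^sub>F d in sequentially. integrable (M d) (\<lambda>\<omega>. ((vnorm d (A d \<omega> - B d \<omega>))\<^sup>2 / real d - (s + t + e))\<^sup>2)"
    using sqint by eventually_elim (use E in \<open>auto simp: W_def\<close>)
  have "V \<in> O(\<lambda>d. real d)"
    using var unfolding variance_bigo_dim_def V_def by simp
  then obtain C where C: "\<forall>\<^sub>F d in sequentially. norm (V d) \<le> C * norm (real d)"
    by (auto elim: landau_o.bigE)
  have V0: "(\<lambda>d. V d / (real d)\<^sup>2) \<longlonglongrightarrow> 0"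
  proof (rule Lim_null_comparison)
    show "\<forall>\<^sub>F d in sequentially. norm (V d / (real d)\<^sup>2) \<le> C / real d"
      using C eventually_gt_at_top[of 0] by eventually_elim (simp add: field_simps power2_eq_square)
  qed (rule lim_const_over_n)
  have "(\<lambda>d. V d / (real d)\<^sup>2 + ((mat_trace d (cov_mat (P d)) + mat_trace d (cov_mat (Q d))
       + (vnorm d (mean_vec (P d) - mean_vec (Q d)))\<^sup>2) / real d - (s + t + e))\<^sup>2)
    \<longlonglongrightarrow> 0 + ((s + t + e) - (s + t + e))\<^sup>2"
    unfolding add_divide_distrib by (intro tendsto_intros V0 lim)
  then have "(\<lambda>d. V d / (real d)\<^sup>2 + ((mat_trace d (cov_mat (P d)) + mat_trace d (cov_mat (Q d))
       + (vnorm d (mean_vec (P d) - mean_vec (Q d)))\<^sup>2) / real d - (s + t + e))\<^sup>2) \<longlonglongrightarrow> 0"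
    by simp
  then have "(\<lambda>d. \<integral>\<omega>. (W d \<omega> / real d - (s + t + e))\<^sup>2 \<partial>M d) \<longlonglongrightarrow> 0"
    by (rule Lim_transform_eventually)
      (use sqint in eventually_elim, use E in auto)
  then show "(\<lambda>d. \<integral>\<omega>. ((vnorm d (A d \<omega> - B d \<omega>))\<^sup>2 / real d - (s + t + e))\<^sup>2 \<partial>M d) \<longlonglongrightarrow> 0"
    by (simp add: W_def)
qed

section \<open>From data vectors to distance matrices, and separation near the limit\<close>

lemma dot_diff_polarisation:
  "dot d (x - z) (y - z) = ((vnorm d (x - z))\<^sup>2 + (vnorm d (y - z))\<^sup>2 - (vnorm d (x - y))\<^sup>2) / 2"
  unfolding dot_def vnorm_sq sum.distrib[symmetric] sum_subtractf[symmetric] sum_divide_distrib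
  by (rule sum.cong) (auto simp: power2_eq_square algebra_simps add_divide_distrib diff_divide_distrib)

text \<open>The scaling by \<open>1 / real d\<close> cancels in the cosine. Coinciding points are
  covered as well, both sides then dividing by zero.\<close>

lemma Ang_eq_vertex_angle:
  assumes "d \<ge> 1"
  shows "Ang d (z i - z v) (z j - z v) = vertex_angle (\<lambda>i j. (vnorm d (z i - z j))\<^sup>2 / real d) v i j"
proof -
  have norm: "sqrt ((vnorm d u)\<^sup>2 / real d) = vnorm d u / sqrt (real d)" for u
    by (simp add: real_sqrt_divide L2_set_nonneg)
  have scale: "(a / real d + b / real d - c / real d) / 2 / (x / sqrt (real d) * (y / sqrt (real d))) =
    (a + b - c) / 2 / (x * y)" for a b c x y
  proof -
    have "a / real d + b / real d - c / real d = (a + b - c) / real d"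
      by (simp add: add_divide_distrib diff_divide_distrib)
    moreover have "x / sqrt (real d) * (y / sqrt (real d)) = x * y / real d"
      by simp
    ultimately show ?thesis using assms by simp
  qed
  show ?thesis
    unfolding Ang_def vertex_angle_def norm scale dot_diff_polarisation ..
qed

lemma U_CvM_eq_U_dist:
  assumes "d \<ge> 1"
  shows "U_CvM d m n (\<lambda>i. z (p i)) (\<lambda>j. z (p (m + j))) =
    U_dist m n (\<lambda>i j. (vnorm d (z i - z j))\<^sup>2 / real d) p"
  by (simp only: U_CvM_def U_dist_def h_CvM_def Ang_eq_vertex_angle[OF assms])

lemma U_CvM_pool:
  "U_CvM d m n x y = U_CvM d m n (\<lambda>i. pool m x y (id i)) (\<lambda>j. pool m x y (id (m + j)))"
proof -
  have "(\<Sum>(i1, i2)\<in>{(i1, i2). i1 < m \<and> i2 < m \<and> i1 \<noteq> i2}.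
      \<Sum>(j1, j2)\<in>{(j1, j2). j1 < n \<and> j2 < n \<and> j1 \<noteq> j2}. h_CvM d (x i1) (x i2) (y j1) (y j2)) =
    (\<Sum>(i1, i2)\<in>{(i1, i2). i1 < m \<and> i2 < m \<and> i1 \<noteq> i2}.
      \<Sum>(j1, j2)\<in>{(j1, j2). j1 < n \<and> j2 < n \<and> j1 \<noteq> j2}.
        h_CvM d (pool m x y (id i1)) (pool m x y (id i2)) (pool m x y (id (m + j1))) (pool m x y (id (m + j2))))"
    by (rule sum_offdiag_cong) (simp add: pool_def)
  then show ?thesis by (simp add: U_CvM_def)
qed

lemma U_dist_measurable:
  assumes p: "p permutes {..<m + n}"
    and D: "\<And>i j. i < m + n \<Longrightarrow> j < m + n \<Longrightarrow> (\<lambda>\<omega>. D \<omega> i j) \<in> borel_measurable N"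
  shows "(\<lambda>\<omega>. U_dist m n (D \<omega>) p) \<in> borel_measurable N"
proof -
  have lt: "p i < m + n" if "i < m + n" for i
    using permutes_in_image[OF p, of i] that by simp
  have angle: "(\<lambda>\<omega>. vertex_angle (D \<omega>) v i j) \<in> borel_measurable N"
    if "v < m + n" "i < m + n" "j < m + n" for v i j
  proof -
    note [measurable] = D[OF that(2,1)] D[OF that(3,1)] D[OF that(2,3)]
    show ?thesis unfolding vertex_angle_def by measurable
  qed
  show ?thesis
    unfolding U_dist_def split_def
    by (intro borel_measurable_times borel_measurable_sum borel_measurable_diff borel_measurable_const angle)
      (auto simp: lt)
qed

text \<open>Each mixed permutation is strictly worse than the identity at the limit, hence also near
  it by continuity. As there are finitely many, one \<epsilon> serves them all.\<close>

lemma exists_separation: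
  fixes a b e :: real
  assumes ab: "a > 0" "b > 0" "e \<ge> 0" "a \<noteq> b \<or> e > 0" and mn: "m \<ge> 2" "n \<ge> 2"
  obtains \<epsilon> where "\<epsilon> > 0"
    and "\<And>D p i j. (\<Sum>i<m + n. \<Sum>j<m + n. (D i j - limit_dist m a b e i j)\<^sup>2) < \<epsilon> \<Longrightarrow>
      p permutes {..<m + n} \<Longrightarrow> i < m \<Longrightarrow> j < n \<Longrightarrow> (p i < m) = (p (m + j) < m) \<Longrightarrow>
      U_dist m n D p < U_dist m n D id"
proof -
  let ?L = "limit_dist m a b e"
  define S where "S D = (\<Sum>i<m + n. \<Sum>j<m + n. (D i j - ?L i j)\<^sup>2)" for D
  \<comment> \<open>The filter of neighbourhoods of the limit matrix, measured by the total squared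
    deviation \<open>S\<close>. Every entry with indices below \<open>m + n\<close> converges along
    it because \<open>S\<close> dominates its squared deviation.\<close>
  define F where "F = filtercomap S (nhds 0)"
  have S0: "(S \<longlongrightarrow> 0) F" unfolding F_def by (rule filterlim_filtercomap)
  have D: "((\<lambda>D. D i j) \<longlongrightarrow> ?L i j) F" if "i < m + n" "j < m + n" for i j
  proof -
    have "(D i j - ?L i j)\<^sup>2 \<le> S D" for D
    proof -
      have "(D i j - ?L i j)\<^sup>2 \<le> (\<Sum>j<m + n. (D i j - ?L i j)\<^sup>2)"
        using that by (intro member_le_sum) auto
      also have "\<dots> \<le> S D"
        unfolding S_def using that
        by (intro member_le_sum[where f = "\<lambda>i. \<Sum>j<m + n. (D i j - ?L i j)\<^sup>2"]) (auto intro: sum_nonneg)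
      finally show ?thesis .
    qed
    then have "((\<lambda>D. (D i j - ?L i j)\<^sup>2) \<longlongrightarrow> 0) F"
      by (intro tendsto_sandwich[OF _ _ tendsto_const S0] always_eventually) auto
    then have "((\<lambda>D. D i j - ?L i j) \<longlongrightarrow> 0) F"
      by (simp add: tendsto_null_power)
    then show ?thesis by (simp add: LIM_zero_iff)
  qed
  define B where "B = {p. p permutes {..<m + n} \<and> (\<exists>i<m. \<exists>j<n. (p i < m) = (p (m + j) < m))}"
  have finB: "finite B"
    by (rule finite_subset[OF _ finite_permutations[of "{..<m + n}"]]) (auto simp: B_def)
  have "\<forall>\<^sub>F D in F. \<forall>p\<in>B. U_dist m n D p < U_dist m n D id"
  proof (intro eventually_ball_finite finB ballI)
    fix p assume "p \<in> B"
    then obtain i j where p: "p permutes {..<m + n}"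
      and mixed: "i < m" "j < n" "(p i < m) = (p (m + j) < m)" by (auto simp: B_def)
    have inj: "inj_on p {..<m + n}" using p by (rule permutes_inj_on)
    have lim: "((\<lambda>D. U_dist m n D q) \<longlongrightarrow> U_dist m n ?L q) F" if "q permutes {..<m + n}" for q
      using that by (intro tendsto_U_dist ab D) (auto simp: permutes_inj_on permutes_image)
    have "\<forall>\<^sub>F D in F. 0 < U_dist m n D id - U_dist m n D p"
      using U_dist_limit_less[OF ab mn inj mixed]
      by (intro order_tendstoD(1)[OF tendsto_diff[OF lim[OF permutes_id] lim[OF p]]]) simp
    then show "\<forall>\<^sub>F D in F. U_dist m n D p < U_dist m n D id" by simp
  qed
  then obtain R where R: "eventually R (nhds 0)" "\<And>D p. R (S D) \<Longrightarrow> p \<in> B \<Longrightarrow> U_dist m n D p < U_dist m n D id"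
    unfolding F_def eventually_filtercomap by blast
  from R(1) obtain \<epsilon> where \<epsilon>: "\<epsilon> > 0" "\<And>x. dist x 0 < \<epsilon> \<Longrightarrow> R x"
    unfolding eventually_nhds_metric by auto
  show ?thesis
  proof (rule that[OF \<epsilon>(1)])
    fix D p i j
    assume less: "(\<Sum>i<m + n. \<Sum>j<m + n. (D i j - ?L i j)\<^sup>2) < \<epsilon>"
      and p: "p permutes {..<m + n}" "i < m" "j < n" "(p i < m) = (p (m + j) < m)"
    have "S D \<ge> 0" by (simp add: S_def sum_nonneg)
    then have "R (S D)" using less by (intro \<epsilon>(2)) (simp add: S_def)
    then show "U_dist m n D p < U_dist m n D id" using p by (intro R(2)) (auto simp: B_def)
  qed
qed

lemma pooled_mean_square_deviation:
  assumes adm: "\<And>d. d \<ge> 1 \<Longrightarrow> admissible d (PX d)" "\<And>d. d \<ge> 1 \<Longrightarrow> admissible d (PY d)"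
    and model: "\<And>d. d \<ge> 1 \<Longrightarrow> two_sample_model d m n (PX d) (PY d) (M d) (X d) (Y d)"
    and A1: "assumption_A1 PX PY" and A2: "assumption_A2 PX PY sX2 sY2 delta2"
    and ij: "i < m + n" "j < m + n"
  defines "D \<equiv> \<lambda>d \<omega>. (vnorm d (pool m (X d) (Y d) i \<omega> - pool m (X d) (Y d) j \<omega>))\<^sup>2 / real d"
  shows "\<forall>\<^sub>F d in sequentially. integrable (M d) (\<lambda>\<omega>. (D d \<omega> - limit_dist m sX2 sY2 delta2 i j)\<^sup>2)"
    and "(\<lambda>d. \<integral>\<omega>. (D d \<omega> - limit_dist m sX2 sY2 delta2 i j)\<^sup>2 \<partial>M d) \<longlonglongrightarrow> 0"
proof -
  \<comment> \<open>With \<open>law\<close>, \<open>s\<close> and \<open>e\<close> the limit off the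
    diagonal is always \<open>s i + s j + e\<close>, so all combinations of samples are treated at
    once.\<close>
  define law where "law k = (if k < m then PX else PY)" for k
  define s where "s k = (if k < m then sX2 else sY2)" for k
  define e where "e = (if (i < m) = (j < m) then 0 else delta2)"
  have prob: "prob_space (M d)" if "d \<ge> 1" for d
    using model[OF that] by (simp add: two_sample_model_def)
  have distr: "distr (M d) (euclid d) (pool m (X d) (Y d) k) = law k d" if "d \<ge> 1" "k < m + n" for d k
  proof -
    have "pool m (X d) (Y d) k = (if k < m then X d k else Y d (k - m))"
      by (simp add: pool_def)
    then show ?thesis
      using model[OF that(1)] that(2) by (auto simp: two_sample_model_def law_def)
  qed
  have sq: "integrable (law k d) (\<lambda>x. (x l)\<^sup>2)" if "l < d" for k d l
    using adm[of d] that by (auto simp: admissible_def law_def)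
  have lim: "(\<lambda>d. mat_trace d (cov_mat (law k d)) / real d) \<longlonglongrightarrow> s k" for k
    using A2 by (auto simp: assumption_A2_def law_def s_def)
  have lim_mean: "(\<lambda>d. (vnorm d (mean_vec (law i d) - mean_vec (law j d)))\<^sup>2 / real d) \<longlonglongrightarrow> e"
  proof (cases "(i < m) = (j < m)")
    case True
    then have "law i = law j" by (simp add: law_def)
    with True show ?thesis by (simp add: e_def L2_set_def)
  next
    case False
    have "vnorm d (mean_vec (PY d) - mean_vec (PX d)) = vnorm d (mean_vec (PX d) - mean_vec (PY d))" for d
      by (rule vnorm_diff_commute)
    with False A2 show ?thesis by (auto simp: assumption_A2_def law_def e_def)
  qed
  have var: "variance_bigo_dim (\<lambda>d. law i d \<Otimes>\<^sub>M law j d) (\<lambda>d (z1, z2). (vnorm d (z1 - z2))\<^sup>2)"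
    using A1 by (auto simp: assumption_A1_def law_def)
  have "(\<forall>\<^sub>F d in sequentially. integrable (M d) (\<lambda>\<omega>. (D d \<omega> - limit_dist m sX2 sY2 delta2 i j)\<^sup>2)) \<and>
    (\<lambda>d. \<integral>\<omega>. (D d \<omega> - limit_dist m sX2 sY2 delta2 i j)\<^sup>2 \<partial>M d) \<longlonglongrightarrow> 0"
  proof (cases "i = j")
    case True
    then show ?thesis by (simp add: D_def limit_dist_def L2_set_def)
  next
    case False
    have indep: "prob_space.indep_var (M d) (euclid d) (pool m (X d) (Y d) i) (euclid d) (pool m (X d) (Y d) j)"
      if "d \<ge> 1" for d
      using prob_space.indep_vars_imp_indep_var[OF prob[OF that], of "\<lambda>_. euclid d" "pool m (X d) (Y d)" "{..<m + n}" i j]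
        model[OF that] ij False by (simp add: two_sample_model_def)
    have "limit_dist m sX2 sY2 delta2 i j = s i + s j + e"
      using False by (auto simp: limit_dist_def s_def e_def)
    then show ?thesis
      using mean_square_deviation_tendsto_0[where P = "law i" and Q = "law j", OF prob indep
          distr[OF _ ij(1)] distr[OF _ ij(2)] sq sq var lim lim lim_mean]
      by (simp add: D_def)
  qed
  then show "\<forall>\<^sub>F d in sequentially. integrable (M d) (\<lambda>\<omega>. (D d \<omega> - limit_dist m sX2 sY2 delta2 i j)\<^sup>2)"
    "(\<lambda>d. \<integral>\<omega>. (D d \<omega> - limit_dist m sX2 sY2 delta2 i j)\<^sup>2 \<partial>M d) \<longlonglongrightarrow> 0" by auto
qed

section \<open>Convergence of the power to 1\<close>

theorem theorem5p1:
  fixes m n :: nat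
    and PX PY :: "nat \<Rightarrow> rvec measure"
    and M :: "nat \<Rightarrow> 'w measure"
    and X Y :: "nat \<Rightarrow> nat \<Rightarrow> 'w \<Rightarrow> rvec"
    and sX2 sY2 delta2 \<alpha> :: real
  assumes "m \<ge> 2" and "n \<ge> 2"
    and "\<And>d. d \<ge> 1 \<Longrightarrow> admissible d (PX d)"
    and "\<And>d. d \<ge> 1 \<Longrightarrow> admissible d (PY d)"
    and "\<And>d. d \<ge> 1 \<Longrightarrow> two_sample_model d m n (PX d) (PY d) (M d) (X d) (Y d)"
    and "assumption_A1 PX PY"
    and "assumption_A2 PX PY sX2 sY2 delta2"
    and "sX2 \<noteq> sY2 \<or> delta2 > 0"
    and "0 < \<alpha>" and "\<alpha> < 1"
    and "m \<noteq> n \<Longrightarrow> \<alpha> > 1 / (fact (m + n) / (fact m * fact n))"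
    and "m = n \<Longrightarrow> \<alpha> > 2 / (fact (m + n) / (fact m * fact n))"
  shows "(\<lambda>d. prob_space.expectation (M d)
            (\<lambda>\<omega>. phi_CvM d m n \<alpha> (\<lambda>i. X d i \<omega>) (\<lambda>j. Y d j \<omega>))) \<longlonglongrightarrow> 1"
proof -
  have pos: "sX2 > 0" "sY2 > 0" "delta2 \<ge> 0"
    using assms(7) by (auto simp: assumption_A2_def)
  obtain \<epsilon> where \<epsilon>: "\<epsilon> > 0"
    and sep: "\<And>D p i j. (\<Sum>i<m + n. \<Sum>j<m + n. (D i j - limit_dist m sX2 sY2 delta2 i j)\<^sup>2) < \<epsilon> \<Longrightarrow>
      p permutes {..<m + n} \<Longrightarrow> i < m \<Longrightarrow> j < n \<Longrightarrow> (p i < m) = (p (m + j) < m) \<Longrightarrow>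
      U_dist m n D p < U_dist m n D id"
    by (rule exists_separation[OF pos assms(8) assms(1,2)]) blast
  define Z where "Z d i \<omega> = pool m (X d) (Y d) i \<omega>" for d i \<omega>
  define D where "D d \<omega> i j = (vnorm d (Z d i \<omega> - Z d j \<omega>))\<^sup>2 / real d" for d \<omega> i j
  define S where "S d \<omega> = (\<Sum>i<m + n. \<Sum>j<m + n. (D d \<omega> i j - limit_dist m sX2 sY2 delta2 i j)\<^sup>2)" for d \<omega>
  define phi where "phi d \<omega> = phi_CvM d m n \<alpha> (\<lambda>i. X d i \<omega>) (\<lambda>j. Y d j \<omega>)" for d \<omega>
  have pool: "pool m (\<lambda>i. X d i \<omega>) (\<lambda>j. Y d j \<omega>) = (\<lambda>i. Z d i \<omega>)" for d \<omega>
    by (simp add: fun_eq_iff pool_def Z_def)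
  have U: "U_CvM d m n (\<lambda>i. Z d (p i) \<omega>) (\<lambda>j. Z d (p (m + j)) \<omega>) = U_dist m n (D d \<omega>) p"
    "U_CvM d m n (\<lambda>i. X d i \<omega>) (\<lambda>j. Y d j \<omega>) = U_dist m n (D d \<omega>) id" if "d \<ge> 1" for d \<omega> p
  proof -
    show *: "U_CvM d m n (\<lambda>i. Z d (p i) \<omega>) (\<lambda>j. Z d (p (m + j)) \<omega>) = U_dist m n (D d \<omega>) p" for p
      using U_CvM_eq_U_dist[OF that, of m n "\<lambda>i. Z d i \<omega>" p] by (simp add: D_def[abs_def])
    show "U_CvM d m n (\<lambda>i. X d i \<omega>) (\<lambda>j. Y d j \<omega>) = U_dist m n (D d \<omega>) id"
      unfolding *[symmetric] by (subst U_CvM_pool) (simp add: pool)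
  qed
  have prob: "prob_space (M d)" if "d \<ge> 1" for d
    using assms(5)[OF that] by (simp add: two_sample_model_def)
  have moments: "\<forall>\<^sub>F d in sequentially. integrable (M d) (\<lambda>\<omega>. (D d \<omega> i j - limit_dist m sX2 sY2 delta2 i j)\<^sup>2)"
    "(\<lambda>d. \<integral>\<omega>. (D d \<omega> i j - limit_dist m sX2 sY2 delta2 i j)\<^sup>2 \<partial>M d) \<longlonglongrightarrow> 0"
    if "i < m + n" "j < m + n" for i j
    using pooled_mean_square_deviation[OF assms(3-7) that] by (simp_all add: D_def Z_def)
  \<comment> \<open>The finitely many pairs share one threshold in \<open>d\<close>; from there on
    the expectation of \<open>S d\<close> may be taken term by term.\<close>
  have int: "\<forall>\<^sub>F d in sequentially. d \<ge> 1 \<and> (\<forall>i\<in>{..<m + n}. \<forall>j\<in>{..<m + n}.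
      integrable (M d) (\<lambda>\<omega>. (D d \<omega> i j - limit_dist m sX2 sY2 delta2 i j)\<^sup>2))"
    by (intro eventually_conj eventually_ge_at_top eventually_ball_finite ballI moments) auto
  have "(\<lambda>d. \<Sum>i<m + n. \<Sum>j<m + n. \<integral>\<omega>. (D d \<omega> i j - limit_dist m sX2 sY2 delta2 i j)\<^sup>2 \<partial>M d) \<longlonglongrightarrow> 0"
    by (intro tendsto_null_sum moments) auto
  then have ES: "(\<lambda>d. \<integral>\<omega>. S d \<omega> \<partial>M d) \<longlonglongrightarrow> 0"
  proof (rule Lim_transform_eventually)
    show "\<forall>\<^sub>F d in sequentially.
        (\<Sum>i<m + n. \<Sum>j<m + n. \<integral>\<omega>. (D d \<omega> i j - limit_dist m sX2 sY2 delta2 i j)\<^sup>2 \<partial>M d) = (\<integral>\<omega>. S d \<omega> \<partial>M d)"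
      using int
    proof eventually_elim
      case (elim d)
      then show ?case
        unfolding S_def
        by (subst Bochner_Integration.integral_sum)
          (auto intro!: sum.cong Bochner_Integration.integral_sum[symmetric]
            Bochner_Integration.integrable_sum)
    qed
  qed
  \<comment> \<open>Measurability makes the bounded test integrable, so that its integral is a
    genuine expectation and not the default value 0.\<close>
  have phi_measurable: "phi d \<in> borel_measurable (M d)" if d: "d \<ge> 1" for d
  proof -
    interpret prob_space "M d" by (rule prob[OF d])
    have "Z d i \<in> M d \<rightarrow>\<^sub>M euclid d" if "i < m + n" for i
      using assms(5)[OF d] that by (auto simp: two_sample_model_def indep_vars_def Z_def[abs_def])
    then have "(\<lambda>\<omega>. D d \<omega> i j) \<in> borel_measurable (M d)" if "i < m + n" "j < m + n" for i j
      unfolding D_def using that by (intro borel_measurable_divide sq_dist_measurable) auto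
    then have [measurable]: "(\<lambda>\<omega>. U_dist m n (D d \<omega>) p) \<in> borel_measurable (M d)" if "p permutes {..<m + n}" for p
      using that by (intro U_dist_measurable) auto
    have [measurable]: "(\<lambda>\<omega>. U_dist m n (D d \<omega>) id) \<in> borel_measurable (M d)"
      by (simp add: permutes_id)
    have [measurable]: "(\<lambda>\<omega>. \<Sum>p\<in>{p. p permutes {..<m + n}}. of_bool (U_dist m n (D d \<omega>) p < U_dist m n (D d \<omega>) id) :: real)
        \<in> borel_measurable (M d)"
      by (intro borel_measurable_sum) (simp, measurable)
    show ?thesis
      unfolding phi_def[abs_def] phi_CvM_eq[OF assms(9,10)] pool U[OF d] by measurable
  qed
  have phi_le: "0 \<le> phi d \<omega>" "phi d \<omega> \<le> 1" for d \<omega>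
    by (auto simp: phi_def phi_CvM_def)
  have S_nonneg: "S d \<omega> \<ge> 0" for d \<omega>
    by (simp add: S_def sum_nonneg)
  \<comment> \<open>A pointwise Markov bound: below \<epsilon> the test rejects by
    \<open>sep\<close>, and from \<epsilon> on the left side is at most 0. Integrating it bounds the
    power below by a quantity tending to 1.\<close>
  have phi_ge: "1 - S d \<omega> / \<epsilon> \<le> phi d \<omega>" if d: "d \<ge> 1" for d \<omega>
  proof (cases "S d \<omega> < \<epsilon>")
    case True
    have "phi_CvM d m n \<alpha> (\<lambda>i. X d i \<omega>) (\<lambda>j. Y d j \<omega>) = 1"
      using assms(1,2) sep[OF True[unfolded S_def]]
      by (intro phi_CvM_eq_1[OF assms(9,10) _ _ assms(11,12)]) (auto simp: pool U[OF d])
    then show ?thesis using S_nonneg[of d \<omega>] \<epsilon> by (simp add: phi_def)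
  next
    case False
    then have "1 \<le> S d \<omega> / \<epsilon>" using \<epsilon> by simp
    then show ?thesis using phi_le(1)[of d \<omega>] by linarith
  qed
  have bounds: "\<forall>\<^sub>F d in sequentially. 1 - (\<integral>\<omega>. S d \<omega> \<partial>M d) / \<epsilon> \<le> (\<integral>\<omega>. phi d \<omega> \<partial>M d) \<and> (\<integral>\<omega>. phi d \<omega> \<partial>M d) \<le> 1"
    using int
  proof eventually_elim
    case (elim d)
    then have d: "d \<ge> 1" by simp
    interpret prob_space "M d" by (rule prob[OF d])
    have intS: "integrable (M d) (S d)"
      unfolding S_def[abs_def] using elim by (intro Bochner_Integration.integrable_sum) auto
    have int_phi: "integrable (M d) (phi d)"
      by (rule integrable_const_bound[where B = 1]) (use phi_le phi_measurable[OF d] in auto)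
    have "1 - (\<integral>\<omega>. S d \<omega> \<partial>M d) / \<epsilon> = (\<integral>\<omega>. 1 - S d \<omega> / \<epsilon> \<partial>M d)"
      using intS by (simp add: prob_space)
    also have "\<dots> \<le> (\<integral>\<omega>. phi d \<omega> \<partial>M d)"
      using intS int_phi phi_ge[OF d] by (intro integral_mono) auto
    finally show ?case
      using integral_le_const[OF int_phi, of 1] phi_le by simp
  qed
  have "(\<lambda>d. 1 - (\<integral>\<omega>. S d \<omega> \<partial>M d) / \<epsilon>) \<longlonglongrightarrow> 1"
    using tendsto_diff[OF tendsto_const tendsto_divide[OF ES tendsto_const], of \<epsilon> 1] \<epsilon> by simp
  then have "(\<lambda>d. \<integral>\<omega>. phi d \<omega> \<partial>M d) \<longlonglongrightarrow> 1"
  proof (rule tendsto_sandwich[rotated 2])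
    show "\<forall>\<^sub>F d in sequentially. 1 - (\<integral>\<omega>. S d \<omega> \<partial>M d) / \<epsilon> \<le> (\<integral>\<omega>. phi d \<omega> \<partial>M d)"
      using bounds by eventually_elim blast
    show "\<forall>\<^sub>F d in sequentially. (\<integral>\<omega>. phi d \<omega> \<partial>M d) \<le> 1"
      using bounds by eventually_elim blast
  qed (rule tendsto_const)
  then show ?thesis by (simp add: phi_def)
qed

end
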